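(* Let $p(y|x)$ and $p(\tilde y|\tilde x)$ be discrete memoryless channels with finite input and output alphabets. If $p(y|x)$ can be simulated from $p(\tilde y|\tilde x)$ in the exact model with infinite shared randomness, then for every $\alpha>0$, $$C_\alpha(p(y|x))\le C_\alpha(p(\tilde y|\tilde x))\qquad\text{and}\qquad \mathsf{Diam}_\alpha(p(y|x))\le\mathsf{Diam}_\alpha(p(\tilde y|\tilde x)).$$
   Context: Logarithms are base 2. Rényi divergence: for $\alpha\in(0,1)\cup(1,\infty)$ and pmfs $p,q$ on a finite set, $D_\alpha(p\|q)=\frac1{\alpha-1}\log\big(\sum_x p_x^\alpha q_x^{1-\alpha}\big)\in[0,\infty]$. For $\alpha=1$, $D_1=D$ is the KL divergence (the limit $\alpha\to1$). $\alpha$-capacity: for $\alpha\in(0,1)\cup(1,\infty)$, $$C_\alpha(p(y|x))=\max_{p(x)}\frac{\alpha}{\alpha-1}\log\Big(\sum_y\Big[\sum_x p(x)p(y|x)^\alpha\Big]^{1/\alpha}\Big),$$ and $C_1(p(y|x))$ is the Shannon capacity. Channel diameter: $\mathsf{Diam}_\alpha(p(y|x))=\max_{p(x),q(x)}D_\alpha(p(y)\|q(y))$ (possibly $+\infty$), where the maximum is over pairs of input pmfs and $p(y)=\sum_x p(x)p(y|x)$, $q(y)=\sum_x q(x)p(y|x)$ are the corresponding output pmfs. Exact simulation: $p(y|x)$ can be simulated from $p(\tilde y|\tilde x)$ in the exact model if for some $n$ there are a shared random variable $\omega$ (independent of the input $x^n$), a stochastic encoder $q^{\mathrm{enc}}(\tilde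 x^n|x^n,\omega)$ and a stochastic decoder $q^{\mathrm{dec}}(y^n|\tilde y^n,\omega)$ such that the induced channel $$q(y^n|x^n)=\sum_{\omega}p(\omega)\sum_{\tilde x^n,\tilde y^n}q^{\mathrm{enc}}(\tilde x^n|x^n,\omega)\Big(\prod_{i=1}^n p(\tilde y_i|\tilde x_i)\Big)q^{\mathrm{dec}}(y^n|\tilde y^n,\omega)$$ satisfies $q(y^n|x^n)=\prod_{i=1}^n p(y_i|x_i)$ for all $x^n,y^n$. Shared randomness of rate $R$ means that $\omega$ is uniform on $[1:2^{nR}]$. Infinite shared randomness means there is no limit on the shared randomness: $\omega$ may be any finite-valued random variable with arbitrary distribution. *)

theory Defs
  imports "HOL-Probability.Probability"
begin

section \<open>Divergences\<close>

text \<open>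
  The library's \<^const>\<open>KL_divergence\<close> takes the reference measure as its first argument and is
  real-valued, hence meaningful only under absolute continuity. The infinite values come from
  \<open>log 0 = -\<infinity>\<close> for \<open>\<alpha> < 1\<close>, where the sum vanishes exactly for disjoint supports, and from
  \<open>0 powr (1 - \<alpha>) = \<infinity>\<close> for \<open>\<alpha> > 1\<close>, with \<open>0 * \<infinity> = 0\<close>.
\<close>

definition renyi_divergence :: "real \<Rightarrow> 'a::finite pmf \<Rightarrow> 'a pmf \<Rightarrow> ereal" where
  "renyi_divergence \<alpha> p q =
     (if \<alpha> < 1 then
        (if set_pmf p \<inter> set_pmf q = {} then \<infinity>
         else ereal (1 / (\<alpha> - 1) *
           log 2 (\<Sum>x\<in>UNIV. pmf p x powr \<alpha> * pmf q x powr (1 - \<alpha>))))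
      else if \<not> set_pmf p \<subseteq> set_pmf q then \<infinity>
      else if \<alpha> = 1 then ereal (KL_divergence 2 (measure_pmf q) (measure_pmf p))
      else ereal (1 / (\<alpha> - 1) *
           log 2 (\<Sum>x\<in>UNIV. pmf p x powr \<alpha> * pmf q x powr (1 - \<alpha>))))"

lemma renyi_sum_eq_0_iff:
  fixes p q :: "'a::finite pmf"
  shows "(\<Sum>x\<in>UNIV. pmf p x powr \<alpha> * pmf q x powr (1 - \<alpha>)) = 0 \<longleftrightarrow> set_pmf p \<inter> set_pmf q = {}"
  by (subst sum_nonneg_eq_0_iff) (auto simp: set_pmf_iff)

lemma KL_divergence_pmf:
  fixes p q :: "'a::finite pmf"
  assumes "set_pmf p \<subseteq> set_pmf q"
  shows "KL_divergence 2 (measure_pmf q) (measure_pmf p) = (\<Sum>x\<in>UNIV. pmf p x * log 2 (pmf p x / pmf q x))"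
proof -
  interpret sigma_finite_measure "count_space (UNIV :: 'a set)"
    by (simp add: sigma_finite_measure_count_space_finite)
  show ?thesis
    unfolding measure_pmf_eq_density[of p] measure_pmf_eq_density[of q]
    using assms
    by (subst KL_density_density)
       (auto simp: AE_count_space set_pmf_iff lebesgue_integral_count_space_finite)
qed

section \<open>Channels\<close>

text \<open>
  A channel \<open>p(y|x)\<close> is a function from inputs to distributions on the outputs.
\<close>

definition output_pmf :: "'x pmf \<Rightarrow> ('x \<Rightarrow> 'y pmf) \<Rightarrow> 'y pmf" where
  "output_pmf p W = bind_pmf p W"

definition joint_pmf :: "'x pmf \<Rightarrow> ('x \<Rightarrow> 'y pmf) \<Rightarrow> ('x \<times> 'y) pmf" where
  "joint_pmf p W = bind_pmf p (\<lambda>x. map_pmf (Pair x) (W x))"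

lemma pmf_output_pmf:
  fixes p :: "'x::finite pmf"
  shows "pmf (output_pmf p W) y = (\<Sum>x\<in>UNIV. pmf p x * pmf (W x) y)"
  by (simp add: output_pmf_def pmf_bind integral_measure_pmf_real[where A = UNIV] mult.commute)

lemma pmf_joint_pmf:
  fixes p :: "'x::finite pmf"
  shows "pmf (joint_pmf p W) (x, y) = pmf p x * pmf (W x) y"
proof -
  have eq: "pmf (map_pmf (Pair x') (W x')) (x, y) = (if x' = x then pmf (W x) y else 0)" for x'
    by (auto simp: pmf_map_inj' inj_on_def pmf_eq_0_set_pmf)
  have "pmf (joint_pmf p W) (x, y) = (\<Sum>x'\<in>UNIV. (if x' = x then pmf (W x) y else 0) * pmf p x')"
    unfolding joint_pmf_def pmf_bind eq by (rule integral_measure_pmf_real) auto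
  also have "\<dots> = (\<Sum>x'\<in>UNIV. if x' = x then pmf p x * pmf (W x) y else 0)"
    by (intro sum.cong) auto
  finally show ?thesis by simp
qed

definition channel_mutual_information :: "'x pmf \<Rightarrow> ('x \<Rightarrow> 'y pmf) \<Rightarrow> real" where
  "channel_mutual_information p W =
     prob_space.mutual_information (measure_pmf (joint_pmf p W)) 2
       (count_space UNIV) (count_space UNIV) fst snd"

lemma pair_pmf_eq_pair_measure:
  fixes p :: "'a::finite pmf" and q :: "'b::finite pmf"
  shows "measure_pmf p \<Otimes>\<^sub>M measure_pmf q = measure_pmf (pair_pmf p q)"
proof -
  have "sets (measure_pmf p \<Otimes>\<^sub>M measure_pmf q) =
      sets (count_space (UNIV :: 'a set) \<Otimes>\<^sub>M count_space (UNIV :: 'b set))"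
    by (rule sets_pair_measure_cong) simp_all
  also have "\<dots> = UNIV"
    by (subst pair_measure_countable) (auto intro: countable_finite)
  finally have sets: "sets (measure_pmf p \<Otimes>\<^sub>M measure_pmf q) = UNIV" .
  show ?thesis
  proof (rule measure_eqI_finite[where A = UNIV])
    fix z :: "'a \<times> 'b"
    obtain x y where z: "z = (x, y)" by force
    have "{(x, y)} = {x} \<times> {y}" by auto
    then have "emeasure (measure_pmf p \<Otimes>\<^sub>M measure_pmf q) {(x, y)} = pmf p x * pmf q y"
      by (simp only:) (subst measure_pmf.emeasure_pair_measure_Times,
        simp_all add: emeasure_pmf_single ennreal_mult)
    then show "emeasure (measure_pmf p \<Otimes>\<^sub>M measure_pmf q) {z} = emeasure (measure_pmf (pair_pmf p q)) {z}"
      by (simp add: z emeasure_pmf_single pmf_pair)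
  qed (simp_all add: sets)
qed

lemma channel_mutual_information_eq:
  fixes p :: "'x::finite pmf" and W :: "'x \<Rightarrow> 'y::finite pmf"
  shows "channel_mutual_information p W =
    (\<Sum>x\<in>UNIV. \<Sum>y\<in>UNIV.
       pmf p x * pmf (W x) y * log 2 (pmf (W x) y / pmf (output_pmf p W) y))"
proof -
  let ?J = "joint_pmf p W" and ?Q = "pair_pmf p (output_pmf p W)"
  have fst: "map_pmf fst ?J = p"
    by (simp add: joint_pmf_def map_bind_pmf pmf.map_comp o_def map_pmf_const bind_return_pmf')
  have snd: "map_pmf snd ?J = output_pmf p W"
    by (simp add: joint_pmf_def output_pmf_def map_bind_pmf pmf.map_comp o_def)
  have "distr (measure_pmf ?J) (count_space UNIV \<Otimes>\<^sub>M count_space UNIV) (\<lambda>z. (fst z, snd z)) = measure_pmf ?J"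
    by (simp add: pair_measure_countable countable_finite flip: map_pmf_rep_eq)
  then have "channel_mutual_information p W = KL_divergence 2 (measure_pmf ?Q) (measure_pmf ?J)"
    by (simp add: channel_mutual_information_def
        prob_space.mutual_information_def[OF prob_space_measure_pmf] fst snd
        pair_pmf_eq_pair_measure flip: map_pmf_rep_eq)
  also have "\<dots> = (\<Sum>z\<in>UNIV. pmf ?J z * log 2 (pmf ?J z / pmf ?Q z))"
    by (intro KL_divergence_pmf) (auto simp: joint_pmf_def output_pmf_def)
  also have "\<dots> = (\<Sum>x\<in>UNIV. \<Sum>y\<in>UNIV. pmf ?J (x, y) * log 2 (pmf ?J (x, y) / pmf ?Q (x, y)))"
    by (simp add: sum.cartesian_product flip: UNIV_Times_UNIV)
  also have "\<dots> = (\<Sum>x\<in>UNIV. \<Sum>y\<in>UNIV.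
       pmf p x * pmf (W x) y * log 2 (pmf (W x) y / pmf (output_pmf p W) y))"
    by (intro sum.cong refl) (simp add: pmf_joint_pmf pmf_pair)
  finally show ?thesis .
qed

text \<open>
  The maxima in the capacity and in the diameter are rendered as suprema in the extended reals,
  over all input distributions. Both maxima are attained, so the value is the same.
\<close>

definition alpha_capacity :: "real \<Rightarrow> ('x::finite \<Rightarrow> 'y::finite pmf) \<Rightarrow> ereal" where
  "alpha_capacity \<alpha> W =
     (if \<alpha> = 1 then (SUP p. ereal (channel_mutual_information p W))
      else (SUP p. ereal (\<alpha> / (\<alpha> - 1) *
             log 2 (\<Sum>y\<in>UNIV. (\<Sum>x\<in>UNIV. pmf p x * pmf (W x) y powr \<alpha>) powr (1 / \<alpha>)))))"

definition channel_diameter :: "real \<Rightarrow> ('x::finite \<Rightarrow> 'y::finite pmf) \<Rightarrow> ereal" where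
  "channel_diameter \<alpha> W =
     (SUP (p, q). renyi_divergence \<alpha> (output_pmf p W) (output_pmf q W))"

section \<open>Exact simulation\<close>

definition seqs :: "nat \<Rightarrow> 'a list set" where
  "seqs n = {xs. length xs = n}"

text \<open>
  Shared randomness is an arbitrary distribution with finite support on the natural numbers,
  which label the values of \<open>\<omega>\<close>. The block length must be positive: for \<open>n = 0\<close> every channel would
  be simulable.
\<close>

definition induced_channel ::
  "nat \<Rightarrow> nat pmf \<Rightarrow> ('x list \<Rightarrow> nat \<Rightarrow> 'u list pmf) \<Rightarrow> ('u::finite \<Rightarrow> 'v::finite pmf) \<Rightarrow>
   ('v list \<Rightarrow> nat \<Rightarrow> 'y list pmf) \<Rightarrow> 'x list \<Rightarrow> 'y list \<Rightarrow> real" where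
  "induced_channel n P enc V dec xs ys =
     (\<Sum>\<omega>\<in>set_pmf P. pmf P \<omega> *
       (\<Sum>us\<in>seqs n. \<Sum>vs\<in>seqs n.
          pmf (enc xs \<omega>) us * (\<Prod>i<n. pmf (V (us ! i)) (vs ! i)) * pmf (dec vs \<omega>) ys))"

definition exactly_simulable ::
  "('x::finite \<Rightarrow> 'y::finite pmf) \<Rightarrow> ('u::finite \<Rightarrow> 'v::finite pmf) \<Rightarrow> bool" where
  "exactly_simulable W V \<longleftrightarrow>
     (\<exists>n\<ge>1. \<exists>P enc dec.
        finite (set_pmf P) \<and>
        (\<forall>xs\<in>seqs n. \<forall>\<omega>\<in>set_pmf P. set_pmf (enc xs \<omega>) \<subseteq> seqs n) \<and>
        (\<forall>vs\<in>seqs n. \<forall>\<omega>\<in>set_pmf P. set_pmf (dec vs \<omega>) \<subseteq> seqs n) \<and>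
        (\<forall>xs\<in>seqs n. \<forall>ys\<in>seqs n.
           induced_channel n P enc V dec xs ys = (\<Prod>i<n. pmf (W (xs ! i)) (ys ! i))))"

end

theory Submission
  imports Defs
begin

text \<open>
  The function \<open>a powr \<alpha> * b powr (1 - \<alpha>)\<close> is homogeneous, jointly subadditive for \<open>\<alpha> > 1\<close> and
  superadditive for \<open>\<alpha> < 1\<close>. Applied to the terms of an exact simulation, this single inequality covers
  the shared randomness, the randomised encoder and the decoder at once: if two channels \<open>V\<close>, \<open>U\<close> are
  used inside the same protocol, the Renyi sum of the two induced outputs on blocks of length \<open>n\<close> is
  at most (for \<open>\<alpha> < 1\<close>: at least) the \<open>n\<close>-th power of the extreme single-letter Renyi sum of \<open>V u\<close>
  and \<open>U u'\<close>. The induced output on a constant block is a product, so \<open>n\<close>-th roots can be taken.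

  With \<open>U = V\<close> this gives the diameter. For the capacity, \<open>U\<close> is the constant channel whose output is the
  minimax optimal distribution of \<open>V\<close>, and the resulting bound on the divergences of \<open>W\<close> from one
  fixed output distribution bounds the Gallager function of \<open>W\<close>, which is multiplicative on product
  inputs. For \<open>\<alpha> = 1\<close> both quantities are the supremum of their values for \<open>\<alpha> < 1\<close>.
\<close>

section \<open>Renyi sums\<close>

text \<open>For positive \<open>b\<close> this is \<open>b * (a / b) powr \<alpha>\<close>, the
  perspective of the power function. Its sum over two pmfs is the argument of the logarithm in
  \<open>renyi_divergence\<close>.\<close>

definition renyi_term :: "real \<Rightarrow> real \<Rightarrow> real \<Rightarrow> real" where
  "renyi_term \<alpha> a b = a powr \<alpha> * b powr (1 - \<alpha>)"

lemma renyi_term_nonneg [simp]: "renyi_term \<alpha> a b \<ge> 0"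
  by (simp add: renyi_term_def)

lemma renyi_term_0_left [simp]: "renyi_term \<alpha> 0 b = 0"
  by (simp add: renyi_term_def)

lemma renyi_term_0_right [simp]: "renyi_term \<alpha> a 0 = 0"
  by (simp add: renyi_term_def)

lemma renyi_term_mult:
  assumes "a \<ge> 0" "b \<ge> 0" "c \<ge> 0" "d \<ge> 0"
  shows "renyi_term \<alpha> (a * c) (b * d) = renyi_term \<alpha> a b * renyi_term \<alpha> c d"
  using assms by (simp add: renyi_term_def powr_mult)

lemma renyi_term_same [simp]: "a \<ge> 0 \<Longrightarrow> renyi_term \<alpha> a a = a"
  by (cases "a = 0") (simp_all add: renyi_term_def flip: powr_add)

lemma renyi_term_scale:
  assumes "c \<ge> 0" "a \<ge> 0" "b \<ge> 0"
  shows "renyi_term \<alpha> (c * a) (c * b) = c * renyi_term \<alpha> a b"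
  using assms by (simp add: renyi_term_mult)

lemma renyi_term_prod:
  assumes "\<And>i. i \<in> I \<Longrightarrow> a i \<ge> 0" "\<And>i. i \<in> I \<Longrightarrow> b i \<ge> 0"
  shows "renyi_term \<alpha> (\<Prod>i\<in>I. a i) (\<Prod>i\<in>I. b i) = (\<Prod>i\<in>I. renyi_term \<alpha> (a i) (b i))"
  using assms
  by (induction I rule: infinite_finite_induct) (simp_all add: renyi_term_mult prod_nonneg)

text \<open>
  In the following inequalities the factor \<open>\<alpha> - 1\<close> merges the cases \<open>\<alpha> > 1\<close> and \<open>\<alpha> < 1\<close>. The side
  conditions for \<open>\<alpha> > 1\<close> exclude the junk value \<open>0 powr (1 - \<alpha>) = 0\<close>.
\<close>

lemma renyi_term_tangent:
  assumes "\<alpha> > 0" "a \<ge> 0" "b \<ge> 0" and ac: "\<alpha> > 1 \<Longrightarrow> b = 0 \<Longrightarrow> a = 0"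
  shows "(\<alpha> - 1) * (\<alpha> * a + (1 - \<alpha>) * b) \<le> (\<alpha> - 1) * renyi_term \<alpha> a b"
proof (cases "a = 0 \<or> b = 0")
  case True
  \<comment> \<open>Here \<open>renyi_term\<close> vanishes, so the tangent side has to be
    nonpositive. The square settles the \<open>b\<close> part, and a nonzero \<open>a\<close> forces
    \<open>b = 0\<close> and hence \<alpha> \<le> 1.\<close>
  have "(\<alpha> - 1) * (\<alpha> * a + (1 - \<alpha>) * b) = \<alpha> * a * (\<alpha> - 1) - (\<alpha> - 1)\<^sup>2 * b"
    by (simp add: algebra_simps power2_eq_square)
  also have "\<dots> \<le> 0"
  proof (cases "a = 0")
    case False
    then have "\<alpha> \<le> 1" using ac True by force
    then have "\<alpha> * a * (\<alpha> - 1) \<le> 0" using assms by (intro mult_nonneg_nonpos) auto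
    then show ?thesis using False True by simp
  qed (use assms in simp)
  finally show ?thesis using True by auto
next
  case pos: False
  show ?thesis
  proof (cases "\<alpha> \<le> 1")
    case True
    then have "renyi_term \<alpha> a b \<le> \<alpha> * a + (1 - \<alpha>) * b"
      unfolding renyi_term_def using assms pos by (intro Youngs_inequality_0) auto
    then show ?thesis using True by (intro mult_left_mono_neg) auto
  next
    case False
    \<comment> \<open>For \<alpha> > 1 Young's inequality is applied in the other direction:
      \<open>a\<close> is the geometric mean of \<open>renyi_term \<alpha> a b\<close> and
      \<open>b\<close> with weights 1/\<alpha> and 1 - 1/\<alpha>.\<close>
    have "(renyi_term \<alpha> a b) powr (1 / \<alpha>) * b powr (1 - 1 / \<alpha>) =
        a * b powr ((1 - \<alpha>) / \<alpha> + (1 - 1 / \<alpha>))"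
      unfolding renyi_term_def powr_add using assms by (simp add: powr_mult powr_powr)
    also have "(1 - \<alpha>) / \<alpha> + (1 - 1 / \<alpha>) = 0"
      using assms by (simp add: field_simps)
    finally have "a = (renyi_term \<alpha> a b) powr (1 / \<alpha>) * b powr (1 - 1 / \<alpha>)"
      using pos by simp
    also have "\<dots> \<le> 1 / \<alpha> * renyi_term \<alpha> a b + (1 - 1 / \<alpha>) * b"
      using assms pos False by (intro Youngs_inequality_0) (auto simp: renyi_term_def)
    finally have "\<alpha> * a \<le> \<alpha> * (1 / \<alpha> * renyi_term \<alpha> a b + (1 - 1 / \<alpha>) * b)"
      using assms by (intro mult_left_mono) auto
    also have "\<dots> = renyi_term \<alpha> a b - (1 - \<alpha>) * b"
      using assms by (simp add: field_simps)
    finally have "\<alpha> * a + (1 - \<alpha>) * b \<le> renyi_term \<alpha> a b" by simp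
    then show ?thesis using False by (intro mult_left_mono) auto
  qed
qed

text \<open>Hoelder's inequality, reversed for \<alpha> > 1. After division by the totals
  \<open>A\<close> and \<open>B\<close>, the tangent bound at (1, 1) is summed; its linear side adds
  up to one, and multiplicativity restores the factor
  \<open>renyi_term \<alpha> A B\<close>.\<close>

lemma renyi_term_sum:
  assumes "\<alpha> > 0" "finite I"
    and a: "\<And>i. i \<in> I \<Longrightarrow> a i \<ge> 0" and b: "\<And>i. i \<in> I \<Longrightarrow> b i \<ge> 0"
    and ac: "\<And>i. i \<in> I \<Longrightarrow> \<alpha> > 1 \<Longrightarrow> b i = 0 \<Longrightarrow> a i = 0"
  shows "(\<alpha> - 1) * renyi_term \<alpha> (\<Sum>i\<in>I. a i) (\<Sum>i\<in>I. b i) \<le> (\<alpha> - 1) * (\<Sum>i\<in>I. renyi_term \<alpha> (a i) (b i))"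
proof (cases "sum a I = 0 \<or> sum b I = 0")
  case True
  then have "renyi_term \<alpha> (a i) (b i) = 0" if "i \<in> I" for i
    using that a b sum_nonneg_eq_0_iff[OF \<open>finite I\<close>, of a] sum_nonneg_eq_0_iff[OF \<open>finite I\<close>, of b]
    by auto
  moreover have "renyi_term \<alpha> (sum a I) (sum b I) = 0" using True by auto
  ultimately show ?thesis by simp
next
  case False
  define A B where "A = sum a I" and "B = sum b I"
  have pos: "A > 0" "B > 0" using False a b by (auto simp: A_def B_def less_le sum_nonneg)
  have "(\<alpha> - 1) * renyi_term \<alpha> A B = renyi_term \<alpha> A B * ((\<alpha> - 1) * (\<alpha> * (A / A) + (1 - \<alpha>) * (B / B)))"
    using pos by simp
  also have "\<alpha> * (A / A) + (1 - \<alpha>) * (B / B) = (\<Sum>i\<in>I. \<alpha> * (a i / A) + (1 - \<alpha>) * (b i / B))"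
    by (simp add: A_def B_def sum.distrib flip: sum_divide_distrib sum_distrib_left times_divide_eq_right)
  also have "(\<alpha> - 1) * \<dots> \<le> (\<Sum>i\<in>I. (\<alpha> - 1) * renyi_term \<alpha> (a i / A) (b i / B))"
    unfolding sum_distrib_left
    using assms pos by (intro sum_mono renyi_term_tangent) auto
  also have "renyi_term \<alpha> A B * \<dots> = (\<Sum>i\<in>I. (\<alpha> - 1) * renyi_term \<alpha> (A * (a i / A)) (B * (b i / B)))"
    unfolding sum_distrib_left using pos a b
    by (intro sum.cong refl, subst renyi_term_mult) auto
  also have "\<dots> = (\<alpha> - 1) * (\<Sum>i\<in>I. renyi_term \<alpha> (a i) (b i))"
    using pos by (simp add: sum_distrib_left)
  finally show ?thesis using pos by (simp add: A_def B_def mult_left_mono)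
qed

text \<open>Joint convexity and data processing in one inequality. The factor
  \<open>w j * K j s t\<close> is common to both arguments and comes out linearly by homogeneity;
  summing over \<open>t\<close> then removes the kernel, and an average over \<open>j\<close> of
  quantities bounded by \<open>M\<close> remains.\<close>

lemma renyi_sum_processing:
  fixes w :: "'j \<Rightarrow> real" and A B :: "'j \<Rightarrow> 's \<Rightarrow> real" and K :: "'j \<Rightarrow> 's \<Rightarrow> 't \<Rightarrow> real"
  assumes "\<alpha> > 0" and fin: "finite J" "finite S" "finite T"
    and w: "\<And>j. j \<in> J \<Longrightarrow> w j \<ge> 0" "sum w J = 1"
    and AB: "\<And>j s. A j s \<ge> 0" "\<And>j s. B j s \<ge> 0"
    and ac: "\<And>j s. j \<in> J \<Longrightarrow> s \<in> S \<Longrightarrow> \<alpha> > 1 \<Longrightarrow> B j s = 0 \<Longrightarrow> A j s = 0"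
    and K: "\<And>j s t. K j s t \<ge> 0" "\<And>j s. j \<in> J \<Longrightarrow> s \<in> S \<Longrightarrow> sum (K j s) T = 1"
    and M: "\<And>j. j \<in> J \<Longrightarrow> (\<alpha> - 1) * (\<Sum>s\<in>S. renyi_term \<alpha> (A j s) (B j s)) \<le> (\<alpha> - 1) * M"
  shows "(\<alpha> - 1) * (\<Sum>t\<in>T. renyi_term \<alpha> (\<Sum>j\<in>J. \<Sum>s\<in>S. w j * A j s * K j s t)
                                         (\<Sum>j\<in>J. \<Sum>s\<in>S. w j * B j s * K j s t)) \<le> (\<alpha> - 1) * M"
proof -
  have scale: "renyi_term \<alpha> (w j * A j s * K j s t) (w j * B j s * K j s t) =
      w j * K j s t * renyi_term \<alpha> (A j s) (B j s)" if "j \<in> J" for j s t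
    using renyi_term_scale[of "w j * K j s t" "A j s" "B j s" \<alpha>] AB K w that by (simp add: mult_ac)
  have "(\<alpha> - 1) * (\<Sum>t\<in>T. renyi_term \<alpha> (\<Sum>j\<in>J. \<Sum>s\<in>S. w j * A j s * K j s t)
                                         (\<Sum>j\<in>J. \<Sum>s\<in>S. w j * B j s * K j s t))
     \<le> (\<alpha> - 1) * (\<Sum>t\<in>T. \<Sum>(j, s)\<in>J \<times> S. w j * K j s t * renyi_term \<alpha> (A j s) (B j s))"
    unfolding sum.cartesian_product[where A = J and B = S] sum_distrib_left[where A = T]
  proof (intro sum_mono)
    fix t assume "t \<in> T"
    have "(\<alpha> - 1) * renyi_term \<alpha> (\<Sum>i\<in>J \<times> S. w (fst i) * A (fst i) (snd i) * K (fst i) (snd i) t)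
        (\<Sum>i\<in>J \<times> S. w (fst i) * B (fst i) (snd i) * K (fst i) (snd i) t)
      \<le> (\<alpha> - 1) * (\<Sum>i\<in>J \<times> S. renyi_term \<alpha> (w (fst i) * A (fst i) (snd i) * K (fst i) (snd i) t)
          (w (fst i) * B (fst i) (snd i) * K (fst i) (snd i) t))"
      using assms by (intro renyi_term_sum) auto
    also have "(\<Sum>i\<in>J \<times> S. renyi_term \<alpha> (w (fst i) * A (fst i) (snd i) * K (fst i) (snd i) t)
          (w (fst i) * B (fst i) (snd i) * K (fst i) (snd i) t)) =
        (\<Sum>i\<in>J \<times> S. w (fst i) * K (fst i) (snd i) t * renyi_term \<alpha> (A (fst i) (snd i)) (B (fst i) (snd i)))"
      by (intro sum.cong refl) (auto simp: scale)
    finally show "(\<alpha> - 1) * renyi_term \<alpha> (\<Sum>(j, s)\<in>J \<times> S. w j * A j s * K j s t)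
        (\<Sum>(j, s)\<in>J \<times> S. w j * B j s * K j s t)
      \<le> (\<alpha> - 1) * (\<Sum>(j, s)\<in>J \<times> S. w j * K j s t * renyi_term \<alpha> (A j s) (B j s))"
      by (simp add: split_def)
  qed
  also have "(\<Sum>t\<in>T. \<Sum>(j, s)\<in>J \<times> S. w j * K j s t * renyi_term \<alpha> (A j s) (B j s)) =
      (\<Sum>(j, s)\<in>J \<times> S. \<Sum>t\<in>T. w j * K j s t * renyi_term \<alpha> (A j s) (B j s))"
    unfolding split_def by (rule sum.swap)
  also have "\<dots> = (\<Sum>(j, s)\<in>J \<times> S. w j * renyi_term \<alpha> (A j s) (B j s))"
    using K by (intro sum.cong refl) (auto simp flip: sum_distrib_left sum_distrib_right)
  also have "\<dots> = (\<Sum>j\<in>J. w j * (\<Sum>s\<in>S. renyi_term \<alpha> (A j s) (B j s)))"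
    by (simp add: sum_distrib_left flip: sum.cartesian_product)
  also have "(\<alpha> - 1) * \<dots> = (\<Sum>j\<in>J. w j * ((\<alpha> - 1) * (\<Sum>s\<in>S. renyi_term \<alpha> (A j s) (B j s))))"
    by (simp add: sum_distrib_left mult_ac)
  also have "\<dots> \<le> (\<Sum>j\<in>J. w j * ((\<alpha> - 1) * M))"
    by (rule sum_mono, rule mult_left_mono) (use w M in auto)
  also have "\<dots> = (\<alpha> - 1) * M"
    using w by (simp flip: sum_distrib_right)
  finally show ?thesis .
qed

section \<open>Induced channels\<close>

lemma finite_seqs [simp]: "finite (seqs n :: 'a::finite list set)"
  unfolding seqs_def using finite_lists_length_eq[of "UNIV :: 'a set" n] by simp

lemma sum_seqs_prod:
  fixes f :: "nat \<Rightarrow> 'a::finite \<Rightarrow> real"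
  shows "(\<Sum>xs\<in>seqs n. \<Prod>i<n. f i (xs ! i)) = (\<Prod>i<n. \<Sum>x\<in>UNIV. f i x)"
proof (induction n arbitrary: f)
  case 0
  have "seqs 0 = {[] :: 'a list}" by (auto simp: seqs_def)
  then show ?case by simp
next
  case (Suc n)
  have seqs: "seqs (Suc n) = (\<lambda>(x, xs). x # xs) ` (UNIV \<times> (seqs n :: 'a list set))"
    by (auto simp: seqs_def image_iff length_Suc_conv)
  have "(\<Sum>xs\<in>seqs (Suc n). \<Prod>i<Suc n. f i (xs ! i)) =
      (\<Sum>(x, xs)\<in>UNIV \<times> seqs n. f 0 x * (\<Prod>i<n. f (Suc i) (xs ! i)))"
    unfolding seqs
    by (subst sum.reindex) (auto simp: inj_on_def prod.lessThan_Suc_shift split_def simp del: prod.lessThan_Suc)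
  also have "\<dots> = (\<Sum>x\<in>UNIV. f 0 x) * (\<Prod>i<n. \<Sum>x\<in>UNIV. f (Suc i) x)"
    by (simp add: Suc.IH[of "\<lambda>i. f (Suc i)"] flip: sum.cartesian_product sum_distrib_left sum_distrib_right)
  finally show ?case
    by (simp add: prod.lessThan_Suc_shift del: prod.lessThan_Suc)
qed

lemma sum_pmf_seqs:
  assumes "set_pmf p \<subseteq> seqs n"
  shows "sum (pmf p) (seqs n :: 'a::finite list set) = 1"
  using assms by (simp add: sum_pmf_eq_1)

lemma mult_diff_1_le_cancel:
  fixes a b :: real
  assumes "\<alpha> \<noteq> 1"
  shows "(\<alpha> - 1) * a \<le> (\<alpha> - 1) * b \<longleftrightarrow> (if \<alpha> > 1 then a \<le> b else b \<le> a)"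
  using assms by (auto simp: mult_le_cancel_left)

text \<open>Passes from letters to blocks. Nonnegativity of the factors and of \<open>M\<close>
  allows multiplication in both directions of the inequality.\<close>

lemma prod_le_power_signed:
  fixes f :: "nat \<Rightarrow> real"
  assumes "\<And>i. i < n \<Longrightarrow> f i \<ge> 0" "M \<ge> 0" "\<And>i. i < n \<Longrightarrow> (\<alpha> - 1) * f i \<le> (\<alpha> - 1) * M"
  shows "(\<alpha> - 1) * (\<Prod>i<n. f i) \<le> (\<alpha> - 1) * M ^ n"
proof -
  consider "\<alpha> = 1" | "\<alpha> > 1" | "\<alpha> < 1" by linarith
  then show ?thesis
  proof cases
    case 2
    then have "(\<Prod>i<n. f i) \<le> (\<Prod>i<n. M)" using assms by (intro prod_mono) auto
    then show ?thesis using 2 by simp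
  next
    case 3
    then have "(\<Prod>i<n. M) \<le> (\<Prod>i<n. f i)" using assms by (intro prod_mono) auto
    then show ?thesis using 3 by simp
  qed simp
qed

lemma power_le_signed_cancel:
  fixes a b :: real
  assumes "n \<ge> 1" "a \<ge> 0" "b \<ge> 0" "(\<alpha> - 1) * a ^ n \<le> (\<alpha> - 1) * b ^ n"
  shows "(\<alpha> - 1) * a \<le> (\<alpha> - 1) * b"
proof (cases "\<alpha> = 1")
  case False
  then show ?thesis
    using assms power_mono_iff[of a b n] power_mono_iff[of b a n]
    by (auto simp: mult_diff_1_le_cancel split: if_splits)
qed simp

lemma induced_channel_eq:
  "induced_channel n P enc V dec xs ys =
    (\<Sum>(\<omega>, us)\<in>set_pmf P \<times> seqs n. \<Sum>vs\<in>seqs n. pmf P \<omega> * pmf (enc xs \<omega>) us *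
       (\<Prod>i<n. pmf (V (us ! i)) (vs ! i)) * pmf (dec vs \<omega>) ys)"
  unfolding induced_channel_def
  by (simp add: sum_distrib_left mult_ac flip: sum.cartesian_product)

lemma induced_channel_nonneg: "induced_channel n P enc V dec xs ys \<ge> 0"
  unfolding induced_channel_def by (intro sum_nonneg mult_nonneg_nonneg prod_nonneg) auto

text \<open>
  Summing also over the codewords of another input puts the outputs for both inputs over one
  common index set.
\<close>

lemma induced_channel_dummy_left:
  assumes enc: "\<And>\<omega>. \<omega> \<in> set_pmf P \<Longrightarrow> set_pmf (enc xs' \<omega>) \<subseteq> seqs n"
  shows "induced_channel n P enc V dec xs ys =
    (\<Sum>(\<omega>, us, us')\<in>set_pmf P \<times> seqs n \<times> seqs n. \<Sum>vs\<in>seqs n.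
       pmf P \<omega> * pmf (enc xs \<omega>) us * pmf (enc xs' \<omega>) us' *
       (\<Prod>i<n. pmf (V (us ! i)) (vs ! i)) * pmf (dec vs \<omega>) ys)"
proof -
  \<comment> \<open>The added codeword \<open>us'\<close> occurs only through its encoding
    probability, which sums to one.\<close>
  have "(\<Sum>us'\<in>seqs n. \<Sum>vs\<in>seqs n. pmf P \<omega> * pmf (enc xs \<omega>) us * pmf (enc xs' \<omega>) us' *
       (\<Prod>i<n. pmf (V (us ! i)) (vs ! i)) * pmf (dec vs \<omega>) ys) =
      (\<Sum>us'\<in>seqs n. pmf (enc xs' \<omega>) us') * (\<Sum>vs\<in>seqs n. pmf P \<omega> * pmf (enc xs \<omega>) us *
       (\<Prod>i<n. pmf (V (us ! i)) (vs ! i)) * pmf (dec vs \<omega>) ys)" for \<omega> us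
    unfolding sum_product by (simp add: mult_ac)
  then show ?thesis
    using enc by (simp add: induced_channel_eq sum_pmf_seqs cong: sum.cong flip: sum.cartesian_product)
qed

text \<open>With the dummy codeword in the first place, exchanging the two inputs gives the same
  index triples and weights as \<open>induced_channel_dummy_left\<close>.\<close>

lemma induced_channel_dummy_right:
  assumes enc: "\<And>\<omega>. \<omega> \<in> set_pmf P \<Longrightarrow> set_pmf (enc xs' \<omega>) \<subseteq> seqs n"
  shows "induced_channel n P enc V dec xs ys =
    (\<Sum>(\<omega>, us', us)\<in>set_pmf P \<times> seqs n \<times> seqs n. \<Sum>vs\<in>seqs n.
       pmf P \<omega> * pmf (enc xs' \<omega>) us' * pmf (enc xs \<omega>) us *
       (\<Prod>i<n. pmf (V (us ! i)) (vs ! i)) * pmf (dec vs \<omega>) ys)"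
  apply (subst induced_channel_dummy_left[where enc = enc and xs' = xs'])
  apply (erule enc)
  apply (simp only: sum.cartesian_product[symmetric])
  apply (rule sum.cong[OF refl])
  apply (rule trans[OF sum.swap])
  apply (intro sum.cong refl)
  apply (simp add: mult_ac)
  done

lemma sum_prod_pmf_seqs:
  fixes p :: "nat \<Rightarrow> 'a::finite pmf"
  shows "(\<Sum>xs\<in>seqs n. \<Prod>i<n. pmf (p i) (xs ! i)) = 1"
  using sum_seqs_prod[of "\<lambda>i. pmf (p i)" n] by (simp add: sum_pmf_eq_1)

text \<open>\<open>induced_channel\<close> is merely a real function; its normalisation is what
  qualifies it as a reference distribution in \<open>simulable_gallager_sum_le\<close>. Decoder,
  channel, encoder and shared randomness are summed out in this order.\<close>

lemma sum_induced_channel: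
  fixes V :: "'u::finite \<Rightarrow> 'v::finite pmf" and dec :: "'v list \<Rightarrow> nat \<Rightarrow> 'y::finite list pmf"
  assumes "finite (set_pmf P)"
    and "\<And>\<omega>. \<omega> \<in> set_pmf P \<Longrightarrow> set_pmf (enc xs \<omega>) \<subseteq> seqs n"
    and "\<And>vs \<omega>. vs \<in> seqs n \<Longrightarrow> \<omega> \<in> set_pmf P \<Longrightarrow> set_pmf (dec vs \<omega>) \<subseteq> seqs n"
  shows "(\<Sum>ys\<in>seqs n. induced_channel n P enc V dec xs ys) = 1"
proof -
  have "(\<Sum>ys\<in>seqs n. induced_channel n P enc V dec xs ys) =
    (\<Sum>\<omega>\<in>set_pmf P. \<Sum>us\<in>seqs n. \<Sum>vs\<in>seqs n. \<Sum>ys\<in>seqs n.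
        pmf P \<omega> * (pmf (enc xs \<omega>) us * ((\<Prod>i<n. pmf (V (us ! i)) (vs ! i)) * pmf (dec vs \<omega>) ys)))"
    unfolding induced_channel_def sum_distrib_left
    by (subst sum.swap, intro sum.cong refl, subst sum.swap, intro sum.cong refl, subst sum.swap) (simp add: mult_ac)
  also have "\<dots> = 1"
    using assms
    by (simp add: sum_pmf_seqs sum_prod_pmf_seqs sum_pmf_eq_1 cong: sum.cong flip: sum_distrib_left)
  finally show ?thesis .
qed

text \<open>An instance of \<open>renyi_sum_processing\<close>: the mixing index consists of
  \<omega> and one codeword for each input, the processed variable is the received block, and the
  kernel is the decoder. The two codewords can differ in every letter, hence the bound for all pairs
  \<open>u\<close>, \<open>u'\<close>.\<close>

lemma renyi_sum_induced:
  fixes V U :: "'u::finite \<Rightarrow> 'v::finite pmf"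
    and enc :: "'x list \<Rightarrow> nat \<Rightarrow> 'u list pmf" and dec :: "'v list \<Rightarrow> nat \<Rightarrow> 'y::finite list pmf"
  assumes "\<alpha> > 0" "finite (set_pmf P)"
    and enc: "\<And>\<omega>. \<omega> \<in> set_pmf P \<Longrightarrow> set_pmf (enc xs \<omega>) \<subseteq> seqs n"
      "\<And>\<omega>. \<omega> \<in> set_pmf P \<Longrightarrow> set_pmf (enc xs' \<omega>) \<subseteq> seqs n"
    and dec: "\<And>vs \<omega>. vs \<in> seqs n \<Longrightarrow> \<omega> \<in> set_pmf P \<Longrightarrow> set_pmf (dec vs \<omega>) \<subseteq> seqs n"
    and M: "M \<ge> 0"
      "\<And>u u'. (\<alpha> - 1) * (\<Sum>v\<in>UNIV. renyi_term \<alpha> (pmf (V u) v) (pmf (U u') v)) \<le> (\<alpha> - 1) * M"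
    and ac: "\<And>u u'. \<alpha> > 1 \<Longrightarrow> set_pmf (V u) \<subseteq> set_pmf (U u')"
  shows "(\<alpha> - 1) * (\<Sum>ys\<in>seqs n. renyi_term \<alpha> (induced_channel n P enc V dec xs ys)
      (induced_channel n P enc U dec xs' ys)) \<le> (\<alpha> - 1) * M ^ n"
proof -
  let ?J = "set_pmf P \<times> seqs n \<times> (seqs n :: 'u list set)"
  let ?w = "\<lambda>(\<omega>, us, us'). pmf P \<omega> * pmf (enc xs \<omega>) us * pmf (enc xs' \<omega>) us'"
  let ?A = "\<lambda>(\<omega> :: nat, us, us' :: 'u list) vs. \<Prod>i<n. pmf (V (us ! i)) (vs ! i)"
  let ?B = "\<lambda>(\<omega> :: nat, us :: 'u list, us') vs. \<Prod>i<n. pmf (U (us' ! i)) (vs ! i)"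
  let ?K = "\<lambda>(\<omega>, us :: 'u list, us' :: 'u list) vs ys. pmf (dec vs \<omega>) ys"
  have eq: "induced_channel n P enc V dec xs ys = (\<Sum>j\<in>?J. \<Sum>vs\<in>seqs n. ?w j * ?A j vs * ?K j vs ys)"
    "induced_channel n P enc U dec xs' ys = (\<Sum>j\<in>?J. \<Sum>vs\<in>seqs n. ?w j * ?B j vs * ?K j vs ys)" for ys
    using induced_channel_dummy_left[where enc = enc and xs' = xs' and P = P and n = n, OF enc(2)]
      induced_channel_dummy_right[where enc = enc and xs' = xs and P = P and n = n, OF enc(1)]
    by (simp_all add: split_def)
  show ?thesis unfolding eq
  proof (rule renyi_sum_processing)
    have "sum ?w ?J = (\<Sum>\<omega>\<in>set_pmf P. pmf P \<omega> *
        ((\<Sum>us\<in>seqs n. pmf (enc xs \<omega>) us) * (\<Sum>us\<in>seqs n. pmf (enc xs' \<omega>) us)))"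
      unfolding sum_product by (simp add: sum_distrib_left mult.assoc flip: sum.cartesian_product)
    also have "\<dots> = 1"
      using enc \<open>finite (set_pmf P)\<close> by (simp add: sum_pmf_seqs sum_pmf_eq_1 cong: sum.cong)
    finally show "sum ?w ?J = 1" .
  next
    fix j :: "nat \<times> 'u list \<times> 'u list" assume "j \<in> ?J"
    obtain \<omega> us us' where j: "j = (\<omega>, us, us')" by (cases j)
    \<comment> \<open>For fixed codewords both block laws are products, so the Renyi sum factorises
      into single-letter sums.\<close>
    have "(\<Sum>vs\<in>seqs n. renyi_term \<alpha> (?A j vs) (?B j vs)) =
        (\<Prod>i<n. \<Sum>v\<in>UNIV. renyi_term \<alpha> (pmf (V (us ! i)) v) (pmf (U (us' ! i)) v))"
      unfolding sum_seqs_prod[symmetric] by (simp add: j renyi_term_prod)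
    then show "(\<alpha> - 1) * (\<Sum>vs\<in>seqs n. renyi_term \<alpha> (?A j vs) (?B j vs)) \<le> (\<alpha> - 1) * M ^ n"
      using M by (simp add: prod_le_power_signed sum_nonneg)
  next
    fix j :: "nat \<times> 'u list \<times> 'u list" and vs :: "'v list" assume "\<alpha> > 1" "?B j vs = 0"
    then obtain i where "i < n" "pmf (U (snd (snd j) ! i)) (vs ! i) = 0" by (auto simp: split_def)
    then have "pmf (V (fst (snd j) ! i)) (vs ! i) = 0"
      using ac[OF \<open>\<alpha> > 1\<close>, of "fst (snd j) ! i" "snd (snd j) ! i"] by (auto simp: set_pmf_iff)
    then show "?A j vs = 0" using \<open>i < n\<close> by (auto simp: split_def)
  next
    fix j :: "nat \<times> 'u list \<times> 'u list" and vs :: "'v list" assume "j \<in> ?J" "vs \<in> seqs n"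
    then show "sum (?K j vs) (seqs n) = 1" using dec by (auto simp: sum_pmf_seqs)
  qed (simp_all add: assms(1,2) split_def prod_nonneg)
qed

text \<open>Absolute continuity passes through the protocol. Given \<omega> and a received block,
  either the decoder cannot output \<open>ys\<close>, or some received letter is impossible under
  \<open>U\<close> and therefore under every input of \<open>V\<close>.\<close>

lemma induced_channel_eq_0:
  fixes V U :: "'u::finite \<Rightarrow> 'v::finite pmf"
    and enc :: "'x list \<Rightarrow> nat \<Rightarrow> 'u list pmf"
  assumes fin: "finite (set_pmf P)"
    and enc: "\<And>\<omega>. \<omega> \<in> set_pmf P \<Longrightarrow> set_pmf (enc xs' \<omega>) \<subseteq> seqs n"
    and ac: "\<And>u u'. set_pmf (V u) \<subseteq> set_pmf (U u')"
    and 0: "induced_channel n P enc U dec xs' ys = 0"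
  shows "induced_channel n P enc V dec xs ys = 0"
proof -
  have "(\<Prod>i<n. pmf (V (us ! i)) (vs ! i)) * pmf (dec vs \<omega>) ys = 0"
    if "\<omega> \<in> set_pmf P" "vs \<in> seqs n" for \<omega> us vs
  proof -
    \<comment> \<open>A single codeword of positive probability suffices, because \<open>ac\<close>
      compares each letter of \<open>us'\<close> with any letter of \<open>us\<close>.\<close>
    obtain us' where us': "us' \<in> set_pmf (enc xs' \<omega>)" using set_pmf_not_empty by fast
    then have "us' \<in> seqs n" using enc that by auto
    moreover have "\<forall>(\<omega>, us)\<in>set_pmf P \<times> seqs n. \<forall>vs\<in>seqs n. pmf P \<omega> * pmf (enc xs' \<omega>) us *
       (\<Prod>i<n. pmf (U (us ! i)) (vs ! i)) * pmf (dec vs \<omega>) ys = 0"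
      using 0 unfolding induced_channel_eq
      by (subst (asm) sum_nonneg_eq_0_iff)
        (auto simp: fin sum_nonneg_eq_0_iff prod_nonneg intro!: sum_nonneg mult_nonneg_nonneg)
    ultimately have "pmf P \<omega> * pmf (enc xs' \<omega>) us' * (\<Prod>i<n. pmf (U (us' ! i)) (vs ! i)) * pmf (dec vs \<omega>) ys = 0"
      using that by blast
    then have "(\<exists>i<n. pmf (U (us' ! i)) (vs ! i) = 0) \<or> pmf (dec vs \<omega>) ys = 0"
      using that us' by (auto simp: set_pmf_iff)
    moreover have "pmf (V (us ! i)) (vs ! i) = 0" if "pmf (U (us' ! i)) (vs ! i) = 0" for i
      using ac[of "us ! i" "us' ! i"] that by (auto simp: set_pmf_iff)
    ultimately show ?thesis by auto
  qed
  then show ?thesis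
    unfolding induced_channel_eq
    by (auto simp: mult.assoc intro!: sum.neutral simp del: prod_zero_iff mult_eq_0_iff)
qed

section \<open>From block simulations to single-letter inequalities\<close>

lemma simulable_renyi_sum_le:
  fixes W :: "'x::finite \<Rightarrow> 'y::finite pmf" and V :: "'u::finite \<Rightarrow> 'v::finite pmf"
  assumes "exactly_simulable W V" "\<alpha> > 0"
    and M: "M \<ge> 0"
      "\<And>u u'. (\<alpha> - 1) * (\<Sum>v\<in>UNIV. renyi_term \<alpha> (pmf (V u) v) (pmf (V u') v)) \<le> (\<alpha> - 1) * M"
    and ac: "\<And>u u'. \<alpha> > 1 \<Longrightarrow> set_pmf (V u) \<subseteq> set_pmf (V u')"
  shows "(\<alpha> - 1) * (\<Sum>y\<in>UNIV. renyi_term \<alpha> (pmf (W x) y) (pmf (W x') y)) \<le> (\<alpha> - 1) * M"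
proof -
  obtain n P enc dec where sim: "n \<ge> 1" "finite (set_pmf P)"
    "\<forall>xs\<in>seqs n. \<forall>\<omega>\<in>set_pmf P. set_pmf (enc xs \<omega>) \<subseteq> seqs n"
    "\<forall>vs\<in>seqs n. \<forall>\<omega>\<in>set_pmf P. set_pmf (dec vs \<omega>) \<subseteq> seqs n"
    "\<forall>xs\<in>seqs n. \<forall>ys\<in>seqs n. induced_channel n P enc V dec xs ys = (\<Prod>i<n. pmf (W (xs ! i)) (ys ! i))"
    using assms(1) unfolding exactly_simulable_def by (elim exE conjE)
  \<comment> \<open>Constant input blocks make the target output an n-fold power of one law, so that
    both sides of the block bound become n-th powers.\<close>
  have rep: "replicate n z \<in> seqs n" for z :: 'x by (simp add: seqs_def)
  have "(\<Sum>y\<in>UNIV. renyi_term \<alpha> (pmf (W x) y) (pmf (W x') y)) ^ n =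
      (\<Sum>ys\<in>seqs n. \<Prod>i<n. renyi_term \<alpha> (pmf (W x) (ys ! i)) (pmf (W x') (ys ! i)))"
    using sum_seqs_prod[of "\<lambda>i y. renyi_term \<alpha> (pmf (W x) y) (pmf (W x') y)" n] by simp
  also have "\<dots> = (\<Sum>ys\<in>seqs n. renyi_term \<alpha>
      (induced_channel n P enc V dec (replicate n x) ys) (induced_channel n P enc V dec (replicate n x') ys))"
  proof (intro sum.cong refl)
    fix ys :: "'y list" assume "ys \<in> seqs n"
    then have "induced_channel n P enc V dec (replicate n z) ys = (\<Prod>i<n. pmf (W z) (ys ! i))" for z
      using sim(5) rep[of z] by simp
    then show "(\<Prod>i<n. renyi_term \<alpha> (pmf (W x) (ys ! i)) (pmf (W x') (ys ! i))) = renyi_term \<alpha>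
      (induced_channel n P enc V dec (replicate n x) ys) (induced_channel n P enc V dec (replicate n x') ys)"
      by (simp add: renyi_term_prod)
  qed
  also have "(\<alpha> - 1) * \<dots> \<le> (\<alpha> - 1) * M ^ n"
  proof (rule renyi_sum_induced)
    show "set_pmf (enc (replicate n x) \<omega>) \<subseteq> seqs n" if "\<omega> \<in> set_pmf P" for \<omega>
      using sim(3) rep[of x] that by blast
    show "set_pmf (enc (replicate n x') \<omega>) \<subseteq> seqs n" if "\<omega> \<in> set_pmf P" for \<omega>
      using sim(3) rep[of x'] that by blast
    show "set_pmf (dec vs \<omega>) \<subseteq> seqs n" if "vs \<in> seqs n" "\<omega> \<in> set_pmf P" for vs \<omega>
      using sim(4) that by blast
  qed (fact assms sim(2))+
  finally show ?thesis
    by (intro power_le_signed_cancel[OF sim(1) _ M(1)]) (simp_all add: sum_nonneg)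
qed

text \<open>For orders at least one, \<open>renyi_divergence\<close> treats missing absolute
  continuity as a separate infinite case that the real-valued Renyi sum does not detect. This lemma
  keeps \<open>W\<close> out of that case.\<close>

lemma simulable_set_pmf_subset:
  fixes W :: "'x::finite \<Rightarrow> 'y::finite pmf" and V :: "'u::finite \<Rightarrow> 'v::finite pmf"
  assumes "exactly_simulable W V"
    and ac: "\<And>u u'. set_pmf (V u) \<subseteq> set_pmf (V u')"
  shows "set_pmf (W x) \<subseteq> set_pmf (W x')"
proof
  fix y assume "y \<in> set_pmf (W x)"
  obtain n P enc dec where sim: "n \<ge> 1" "finite (set_pmf P)"
    "\<forall>xs\<in>seqs n. \<forall>\<omega>\<in>set_pmf P. set_pmf (enc xs \<omega>) \<subseteq> seqs n"
    "\<forall>vs\<in>seqs n. \<forall>\<omega>\<in>set_pmf P. set_pmf (dec vs \<omega>) \<subseteq> seqs n"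
    "\<forall>xs\<in>seqs n. \<forall>ys\<in>seqs n. induced_channel n P enc V dec xs ys = (\<Prod>i<n. pmf (W (xs ! i)) (ys ! i))"
    using assms(1) unfolding exactly_simulable_def by (elim exE conjE)
  have rep: "replicate n z \<in> seqs n" for z :: 'z by (simp add: seqs_def)
  have eq: "induced_channel n P enc V dec (replicate n z) (replicate n y) = pmf (W z) y ^ n" for z
    by (simp add: sim(5) rep seqs_def)
  show "y \<in> set_pmf (W x')"
  proof (rule ccontr)
    assume "y \<notin> set_pmf (W x')"
    \<comment> \<open>The condition \<open>n \<ge> 1\<close> enters here, since the power
      \<open>0 ^ 0\<close> would be one.\<close>
    then have "induced_channel n P enc V dec (replicate n x') (replicate n y) = 0"
      using sim(1) by (simp add: eq pmf_eq_0_set_pmf power_0_left)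
    then have "induced_channel n P enc V dec (replicate n x) (replicate n y) = 0"
      by (rule induced_channel_eq_0[where V = V and U = V, rotated -1])
        (simp_all add: sim(2) sim(3)[rule_format, OF rep] ac)
    then show False using \<open>y \<in> set_pmf (W x)\<close> by (simp add: eq set_pmf_iff)
  qed
qed

text \<open>The diameter ranges over mixed inputs, while simulation compares pure letters. The gap
  is closed by \<open>renyi_sum_processing\<close> with the independent pair of inputs as mixing
  index and the identity as kernel \<open>?K\<close>.\<close>

lemma renyi_sum_output_le:
  fixes W :: "'x::finite \<Rightarrow> 'y::finite pmf"
  assumes "\<alpha> > 0"
    and M: "\<And>x x'. (\<alpha> - 1) * (\<Sum>y\<in>UNIV. renyi_term \<alpha> (pmf (W x) y) (pmf (W x') y)) \<le> (\<alpha> - 1) * M"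
    and ac: "\<And>x x'. \<alpha> > 1 \<Longrightarrow> set_pmf (W x) \<subseteq> set_pmf (W x')"
  shows "(\<alpha> - 1) * (\<Sum>y\<in>UNIV. renyi_term \<alpha> (pmf (output_pmf p W) y) (pmf (output_pmf q W) y)) \<le> (\<alpha> - 1) * M"
proof -
  let ?w = "\<lambda>(x, x'). pmf p x * pmf q x'"
  let ?K = "\<lambda>(x :: 'x, x' :: 'x) y t. if t = y then 1 else 0 :: real"
  have delta: "(\<Sum>y\<in>UNIV. c * f y * (if t = y then 1 else 0)) = c * f t"
    for c and f :: "'y \<Rightarrow> real" and t :: 'y
    by (simp add: if_distrib cong: if_cong)
  have "pmf (output_pmf p W) t = (\<Sum>x\<in>UNIV. \<Sum>x'\<in>UNIV. pmf p x * pmf q x' * pmf (W x) t)" for t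
    by (simp add: pmf_output_pmf sum_pmf_eq_1 flip: sum_distrib_left sum_distrib_right)
  then have p: "pmf (output_pmf p W) t = (\<Sum>j\<in>UNIV \<times> UNIV. \<Sum>y\<in>UNIV. ?w j * pmf (W (fst j)) y * ?K j y t)" for t
    by (simp only: split_def delta sum.cartesian_product)
  have "pmf (output_pmf q W) t = (\<Sum>x\<in>UNIV. \<Sum>x'\<in>UNIV. pmf p x * pmf q x' * pmf (W x') t)" for t
    by (simp add: pmf_output_pmf sum_pmf_eq_1 mult.assoc flip: sum_distrib_left sum_distrib_right)
  then have q: "pmf (output_pmf q W) t = (\<Sum>j\<in>UNIV \<times> UNIV. \<Sum>y\<in>UNIV. ?w j * pmf (W (snd j)) y * ?K j y t)" for t
    by (simp only: split_def delta sum.cartesian_product)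
  have "sum ?w (UNIV \<times> UNIV) = 1"
    unfolding sum.cartesian_product[symmetric] by (simp add: sum_pmf_eq_1 flip: sum_distrib_left)
  then show ?thesis unfolding p q
  proof (intro renyi_sum_processing)
    fix j :: "'x \<times> 'x" and y assume "\<alpha> > 1" "pmf (W (snd j)) y = 0"
    then show "pmf (W (fst j)) y = 0" using ac[of "fst j" "snd j"] by (auto simp: set_pmf_iff)
  qed (use assms(1) M in \<open>simp_all add: split_def\<close>)
qed

section \<open>The channel diameter\<close>

lemma renyi_divergence_mono:
  fixes p q :: "'a::finite pmf" and p' q' :: "'b::finite pmf"
  assumes "\<alpha> > 0" "\<alpha> \<noteq> 1"
    and le: "(\<alpha> - 1) * (\<Sum>x\<in>UNIV. renyi_term \<alpha> (pmf p x) (pmf q x)) \<le>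
      (\<alpha> - 1) * (\<Sum>x\<in>UNIV. renyi_term \<alpha> (pmf p' x) (pmf q' x))"
    and ac: "\<alpha> > 1 \<Longrightarrow> set_pmf p \<subseteq> set_pmf q"
  shows "renyi_divergence \<alpha> p q \<le> renyi_divergence \<alpha> p' q'"
proof -
  define S S' where "S = (\<Sum>x\<in>UNIV. pmf p x powr \<alpha> * pmf q x powr (1 - \<alpha>))"
    and "S' = (\<Sum>x\<in>UNIV. pmf p' x powr \<alpha> * pmf q' x powr (1 - \<alpha>))"
  have 0: "S \<ge> 0" "S' \<ge> 0" by (auto simp: S_def S'_def intro: sum_nonneg)
  have S0: "S = 0 \<longleftrightarrow> set_pmf p \<inter> set_pmf q = {}" "S' = 0 \<longleftrightarrow> set_pmf p' \<inter> set_pmf q' = {}"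
    unfolding S_def S'_def by (rule renyi_sum_eq_0_iff)+
  have le: "if \<alpha> > 1 then S \<le> S' else S' \<le> S"
    using le \<open>\<alpha> \<noteq> 1\<close> by (simp add: mult_diff_1_le_cancel S_def S'_def renyi_term_def)
  show ?thesis
  proof (cases "\<alpha> > 1")
    case True
    \<comment> \<open>Absolute continuity makes the supports meet, so the logarithm is taken of a
      positive number.\<close>
    then have "S > 0" using ac S0(1) 0(1) set_pmf_not_empty[of p] by (auto simp: less_le)
    then have "1 / (\<alpha> - 1) * log 2 S \<le> 1 / (\<alpha> - 1) * log 2 S'"
      using le True by (intro mult_left_mono) auto
    then show ?thesis
      using True ac by (auto simp: renyi_divergence_def simp flip: S_def S'_def)
  next
    case False
    \<comment> \<open>If \<open>S' = 0\<close> the right-hand divergence is infinite; otherwise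
      \<open>S\<close> is positive as well, and the negative factor reverses the order of the
      logarithms.\<close>
    have "1 / (\<alpha> - 1) * log 2 S \<le> 1 / (\<alpha> - 1) * log 2 S'" if "S' > 0"
      using le False \<open>\<alpha> \<noteq> 1\<close> that by (intro mult_left_mono_neg) auto
    then show ?thesis
      using False \<open>\<alpha> \<noteq> 1\<close> 0 le
      by (auto simp: renyi_divergence_def less_le simp flip: S_def S'_def S0)
  qed
qed

lemma renyi_divergence_le_channel_diameter:
  "renyi_divergence \<alpha> (V u) (V u') \<le> channel_diameter \<alpha> V"
  unfolding channel_diameter_def
  by (rule SUP_upper2[of "(return_pmf u, return_pmf u')"]) (simp_all add: output_pmf_def bind_return_pmf)

lemma channel_diameter_infinite:
  assumes "\<alpha> \<ge> 1" "\<not> set_pmf (V u) \<subseteq> set_pmf (V u')"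
  shows "channel_diameter \<alpha> V = \<infinity>"
  using renyi_divergence_le_channel_diameter[of \<alpha> V u u'] assms
  by (simp add: renyi_divergence_def)

lemma set_pmf_output_subset:
  assumes "\<And>x x'. set_pmf (W x) \<subseteq> set_pmf (W x')"
  shows "set_pmf (output_pmf p W) \<subseteq> set_pmf (output_pmf q W)"
proof
  fix y assume "y \<in> set_pmf (output_pmf p W)"
  then obtain x where "y \<in> set_pmf (W x)" by (auto simp: output_pmf_def)
  moreover obtain x' where "x' \<in> set_pmf q" using set_pmf_not_empty by fast
  ultimately show "y \<in> set_pmf (output_pmf q W)"
    using assms[of x x'] by (auto simp: output_pmf_def)
qed

text \<open>Apart from the case of infinite diameter of \<open>V\<close>, the extreme Renyi sum over
  pairs of letters of \<open>V\<close> is attained. It bounds all outputs of \<open>W\<close>, and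
  the divergence of the extreme pair is itself below the diameter of \<open>V\<close>.\<close>

lemma channel_diameter_mono:
  fixes W :: "'x::finite \<Rightarrow> 'y::finite pmf" and V :: "'u::finite \<Rightarrow> 'v::finite pmf"
  assumes sim: "exactly_simulable W V" and \<alpha>: "\<alpha> > 0" "\<alpha> \<noteq> 1"
  shows "channel_diameter \<alpha> W \<le> channel_diameter \<alpha> V"
proof (cases "\<alpha> > 1 \<and> (\<exists>u u'. \<not> set_pmf (V u) \<subseteq> set_pmf (V u'))")
  case True
  then obtain u u' where "\<not> set_pmf (V u) \<subseteq> set_pmf (V u')" by blast
  with True channel_diameter_infinite[of \<alpha> V u u'] show ?thesis by simp
next
  case False
  then have acV: "set_pmf (V u) \<subseteq> set_pmf (V u')" if "\<alpha> > 1" for u u' using that by blast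
  have acW: "set_pmf (W x) \<subseteq> set_pmf (W x')" if "\<alpha> > 1" for x x'
    using simulable_set_pmf_subset[OF sim acV[OF that]] .
  define S where "S u u' = (\<Sum>v\<in>UNIV. renyi_term \<alpha> (pmf (V u) v) (pmf (V u') v))" for u u'
  \<comment> \<open>Because of the sign of \<alpha> - 1, the maximum of \<open>?f\<close> picks the
    largest sum for \<alpha> > 1 and the smallest for \<alpha> < 1.\<close>
  let ?f = "\<lambda>z. (\<alpha> - 1) * S (fst z) (snd z)"
  have "Max (range ?f) \<in> range ?f" by (rule Max_in) auto
  then obtain z where "Max (range ?f) = ?f z" by blast
  moreover have "?f z' \<le> Max (range ?f)" for z' by (rule Max_ge) auto
  ultimately obtain u0 u1 where max: "\<And>u u'. (\<alpha> - 1) * S u u' \<le> (\<alpha> - 1) * S u0 u1"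
    by (metis fst_conv snd_conv)
  have "S u0 u1 \<ge> 0" by (simp add: S_def sum_nonneg)
  then have W: "(\<alpha> - 1) * (\<Sum>y\<in>UNIV. renyi_term \<alpha> (pmf (W x) y) (pmf (W x') y)) \<le> (\<alpha> - 1) * S u0 u1" for x x'
    using max acV by (intro simulable_renyi_sum_le[OF sim]) (auto simp: \<alpha> S_def)
  have "renyi_divergence \<alpha> (output_pmf p W) (output_pmf q W) \<le> renyi_divergence \<alpha> (V u0) (V u1)" for p q
    using renyi_sum_output_le[OF \<alpha>(1) W acW] set_pmf_output_subset[OF acW]
    by (intro renyi_divergence_mono \<alpha>) (simp_all add: S_def)
  also have "\<dots> \<le> channel_diameter \<alpha> V" by (rule renyi_divergence_le_channel_diameter)
  finally show ?thesis by (subst (1) channel_diameter_def) (auto intro: SUP_least)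
qed

section \<open>The capacity\<close>

text \<open>This is exp(-E_0), where E_0 is Gallager's function at the parameter 1/\<alpha> - 1. Its
  logarithm times \<alpha> / (\<alpha> - 1) is Sibson's mutual information of order
  \<alpha>.\<close>

definition gallager_sum :: "real \<Rightarrow> 'x::finite pmf \<Rightarrow> ('x \<Rightarrow> 'y::finite pmf) \<Rightarrow> real" where
  "gallager_sum \<alpha> p W = (\<Sum>y\<in>UNIV. (\<Sum>x\<in>UNIV. pmf p x * pmf (W x) y powr \<alpha>) powr (1 / \<alpha>))"

lemma gallager_sum_pos: "gallager_sum \<alpha> p W > 0"
proof -
  obtain x where x: "x \<in> set_pmf p" using set_pmf_not_empty by fast
  obtain y where y: "y \<in> set_pmf (W x)" using set_pmf_not_empty by fast
  have "0 < pmf p x * pmf (W x) y powr \<alpha>" using x y by (simp add: pmf_positive set_pmf_iff zero_less_mult_iff)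
  then have "0 < (\<Sum>x\<in>UNIV. pmf p x * pmf (W x) y powr \<alpha>)"
    by (intro sum_pos2[of UNIV x]) auto
  then show ?thesis
    unfolding gallager_sum_def by (intro sum_pos2[of UNIV y]) auto
qed

text \<open>The inequality half of Sibson's identity. As \<open>q\<close> has total mass one, the
  left side is a \<open>renyi_term\<close> of two sums, and after \<open>renyi_term_sum\<close> the
  outer power cancels, leaving an expression linear in \<open>h\<close>.\<close>

lemma powr_sum_le_renyi_sum:
  fixes p :: "'a \<Rightarrow> real" and w :: "'a \<Rightarrow> 'b \<Rightarrow> real" and q :: "'b \<Rightarrow> real"
  assumes "\<alpha> > 0" "finite X" "finite Y"
    and p: "\<And>x. x \<in> X \<Longrightarrow> p x \<ge> 0" and w: "\<And>x y. x \<in> X \<Longrightarrow> w x y \<ge> 0"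
    and q: "\<And>y. y \<in> Y \<Longrightarrow> q y \<ge> 0" "sum q Y = 1"
    and ac: "\<And>x y. x \<in> X \<Longrightarrow> y \<in> Y \<Longrightarrow> \<alpha> > 1 \<Longrightarrow> q y = 0 \<Longrightarrow> p x * w x y = 0"
  shows "(\<alpha> - 1) * (\<Sum>y\<in>Y. (\<Sum>x\<in>X. p x * w x y powr \<alpha>) powr (1 / \<alpha>)) powr \<alpha>
      \<le> (\<alpha> - 1) * (\<Sum>x\<in>X. p x * (\<Sum>y\<in>Y. renyi_term \<alpha> (w x y) (q y)))"
proof -
  define h where "h y = (\<Sum>x\<in>X. p x * w x y powr \<alpha>)" for y
  have h: "h y \<ge> 0" for y unfolding h_def using p by (intro sum_nonneg) auto
  have h0: "h y = 0" if "y \<in> Y" "\<alpha> > 1" "q y = 0" for y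
    unfolding h_def using ac[OF _ that] by (intro sum.neutral) auto
  have "(\<Sum>y\<in>Y. h y powr (1 / \<alpha>)) powr \<alpha> = renyi_term \<alpha> (\<Sum>y\<in>Y. h y powr (1 / \<alpha>)) (\<Sum>y\<in>Y. q y)"
    using q(2) by (simp add: renyi_term_def)
  also have "(\<alpha> - 1) * \<dots> \<le> (\<alpha> - 1) * (\<Sum>y\<in>Y. renyi_term \<alpha> (h y powr (1 / \<alpha>)) (q y))"
    using assms h0 by (intro renyi_term_sum) auto
  also have "(\<Sum>y\<in>Y. renyi_term \<alpha> (h y powr (1 / \<alpha>)) (q y)) =
      (\<Sum>y\<in>Y. \<Sum>x\<in>X. p x * renyi_term \<alpha> (w x y) (q y))"
    using \<open>\<alpha> > 0\<close> h by (intro sum.cong refl)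
      (simp add: renyi_term_def powr_powr h_def sum_distrib_right mult.assoc)
  also have "\<dots> = (\<Sum>x\<in>X. p x * (\<Sum>y\<in>Y. renyi_term \<alpha> (w x y) (q y)))"
    unfolding sum_distrib_left by (rule sum.swap)
  finally show ?thesis unfolding h_def .
qed

lemma prod_powr:
  fixes f :: "'a \<Rightarrow> real"
  assumes "\<And>i. i \<in> I \<Longrightarrow> f i \<ge> 0"
  shows "(\<Prod>i\<in>I. f i) powr a = (\<Prod>i\<in>I. f i powr a)"
  using assms by (induction I rule: infinite_finite_induct) (simp_all add: powr_mult prod_nonneg)

text \<open>Distributivity is used twice: on the inputs inside the outer power, then on the
  outputs.\<close>

lemma gallager_sum_power:
  "(\<Sum>ys\<in>seqs n. (\<Sum>xs\<in>seqs n. (\<Prod>i<n. pmf p (xs ! i)) *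
      (\<Prod>i<n. pmf (W (xs ! i)) (ys ! i)) powr \<alpha>) powr (1 / \<alpha>)) = gallager_sum \<alpha> p W ^ n"
proof -
  let ?h = "\<lambda>y. \<Sum>x\<in>UNIV. pmf p x * pmf (W x) y powr \<alpha>"
  have "(\<Sum>xs\<in>seqs n. (\<Prod>i<n. pmf p (xs ! i)) * (\<Prod>i<n. pmf (W (xs ! i)) (ys ! i)) powr \<alpha>) =
      (\<Prod>i<n. ?h (ys ! i))" for ys
    using sum_seqs_prod[of "\<lambda>i x. pmf p x * pmf (W x) (ys ! i) powr \<alpha>" n]
    by (simp add: prod_powr prod.distrib)
  moreover have "(\<Prod>i<n. ?h (ys ! i)) powr (1 / \<alpha>) = (\<Prod>i<n. ?h (ys ! i) powr (1 / \<alpha>))" for ys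
    by (intro prod_powr sum_nonneg) auto
  ultimately show ?thesis
    using sum_seqs_prod[of "\<lambda>i y. ?h y powr (1 / \<alpha>)" n] by (simp add: gallager_sum_def)
qed

text \<open>Running the protocol over the constant channel \<open>q\<close> yields one output law
  \<open>Q\<close> against which every block law of \<open>W\<close> is compared.
  \<open>powr_sum_le_renyi_sum\<close> accepts any reference distribution, so \<open>Q\<close> may
  be correlated across letters; the product structure comes from the input weights.\<close>

lemma simulable_gallager_sum_le:
  fixes W :: "'x::finite \<Rightarrow> 'y::finite pmf" and V :: "'u::finite \<Rightarrow> 'v::finite pmf"
  assumes "exactly_simulable W V" "\<alpha> > 0"
    and M: "M \<ge> 0"
      "\<And>u. (\<alpha> - 1) * (\<Sum>v\<in>UNIV. renyi_term \<alpha> (pmf (V u) v) (pmf q v)) \<le> (\<alpha> - 1) * M"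
    and ac: "\<And>u. \<alpha> > 1 \<Longrightarrow> set_pmf (V u) \<subseteq> set_pmf q"
  shows "(\<alpha> - 1) * gallager_sum \<alpha> p W powr \<alpha> \<le> (\<alpha> - 1) * M"
proof -
  obtain n P enc dec where sim: "n \<ge> 1" "finite (set_pmf P)"
    "\<forall>xs\<in>seqs n. \<forall>\<omega>\<in>set_pmf P. set_pmf (enc xs \<omega>) \<subseteq> seqs n"
    "\<forall>vs\<in>seqs n. \<forall>\<omega>\<in>set_pmf P. set_pmf (dec vs \<omega>) \<subseteq> seqs n"
    "\<forall>xs\<in>seqs n. \<forall>ys\<in>seqs n. induced_channel n P enc V dec xs ys = (\<Prod>i<n. pmf (W (xs ! i)) (ys ! i))"
    using assms(1) unfolding exactly_simulable_def by (elim exE conjE)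
  \<comment> \<open>A constant channel conveys nothing about its input, so an arbitrary block will
    do.\<close>
  define x0 :: "'x list" where "x0 = replicate n undefined"
  have x0: "x0 \<in> seqs n" by (simp add: x0_def seqs_def)
  define Q where "Q = induced_channel n P enc (\<lambda>_. q) dec x0"
  let ?S = "\<lambda>xs. \<Sum>ys\<in>seqs n. renyi_term \<alpha> (\<Prod>i<n. pmf (W (xs ! i)) (ys ! i)) (Q ys)"
  have enc: "set_pmf (enc xs \<omega>) \<subseteq> seqs n" if "xs \<in> seqs n" "\<omega> \<in> set_pmf P" for xs \<omega>
    using sim(3) that by blast
  have dec: "set_pmf (dec vs \<omega>) \<subseteq> seqs n" if "vs \<in> seqs n" "\<omega> \<in> set_pmf P" for vs \<omega>
    using sim(4) that by blast
  have Q_sum: "sum Q (seqs n) = 1"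
    unfolding Q_def by (rule sum_induced_channel) (use sim(2) enc[OF x0] dec in auto)
  have Q0: "(\<Prod>i<n. pmf (W (xs ! i)) (ys ! i)) = 0"
    if "xs \<in> seqs n" "ys \<in> seqs n" "\<alpha> > 1" "Q ys = 0" for xs ys
  proof -
    have "induced_channel n P enc V dec xs ys = 0"
      by (rule induced_channel_eq_0[where U = "\<lambda>_. q" and V = V and xs' = x0])
        (use that in \<open>simp_all add: sim(2) enc[OF x0] ac Q_def\<close>)
    then show ?thesis using sim(5) that by simp
  qed
  have S: "(\<alpha> - 1) * ?S xs \<le> (\<alpha> - 1) * M ^ n" if "xs \<in> seqs n" for xs
  proof -
    have "?S xs = (\<Sum>ys\<in>seqs n. renyi_term \<alpha> (induced_channel n P enc V dec xs ys) (Q ys))"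
      using sim(5) that by (intro sum.cong refl) simp
    also have "(\<alpha> - 1) * \<dots> \<le> (\<alpha> - 1) * M ^ n" unfolding Q_def
      by (rule renyi_sum_induced) (fact assms(2) sim(2) enc[OF that] enc[OF x0] dec M ac)+
    finally show ?thesis .
  qed
  have "(gallager_sum \<alpha> p W powr \<alpha>) ^ n = (gallager_sum \<alpha> p W ^ n) powr \<alpha>"
    using prod_powr[of "{..<n}" "\<lambda>_. gallager_sum \<alpha> p W" \<alpha>] gallager_sum_pos[of \<alpha> p W] by simp
  also have "(\<alpha> - 1) * \<dots> \<le> (\<alpha> - 1) * (\<Sum>xs\<in>seqs n. (\<Prod>i<n. pmf p (xs ! i)) * ?S xs)"
    unfolding gallager_sum_power[symmetric]
  proof (rule powr_sum_le_renyi_sum)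
    show "0 \<le> Q ys" for ys by (simp add: Q_def induced_channel_nonneg)
    show "(\<Prod>i<n. pmf p (xs ! i)) * (\<Prod>i<n. pmf (W (xs ! i)) (ys ! i)) = 0"
      if "xs \<in> seqs n" "ys \<in> seqs n" "\<alpha> > 1" "Q ys = 0" for xs ys
      using Q0[OF that] by simp
  qed (simp_all add: assms(2) Q_sum prod_nonneg)
  also have "\<dots> = (\<Sum>xs\<in>seqs n. (\<Prod>i<n. pmf p (xs ! i)) * ((\<alpha> - 1) * ?S xs))"
    by (simp add: sum_distrib_left mult.left_commute)
  also have "\<dots> \<le> (\<Sum>xs\<in>seqs n. (\<Prod>i<n. pmf p (xs ! i)) * ((\<alpha> - 1) * M ^ n))"
    by (rule sum_mono, rule mult_left_mono[OF S]) (simp_all add: prod_nonneg)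
  also have "\<dots> = (\<alpha> - 1) * M ^ n"
    using sum_prod_pmf_seqs[of "\<lambda>_. p" n] by (simp flip: sum_distrib_right)
  finally show ?thesis
    by (rule power_le_signed_cancel[OF sim(1) _ M(1), rotated]) simp
qed

section \<open>Optimal inputs and the dual output distribution\<close>

lemma ex_pmf_eq:
  fixes f :: "'a::finite \<Rightarrow> real"
  assumes "\<And>x. f x \<ge> 0" "sum f UNIV = 1"
  obtains p where "\<And>x. pmf p x = f x"
proof
  show "pmf (embed_pmf f) x = f x" for x
    using assms by (intro pmf_embed_pmf) (simp_all add: nn_integral_count_space_finite)
qed

text \<open>Pmfs are identified with the compact probability simplex in \<open>real ^ 'a\<close>.
  Continuity is asked for only on the nonnegative orthant, where \<open>powr\<close> with a positive
  exponent is continuous.\<close>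

lemma ex_maximizing_pmf:
  fixes F :: "('a::finite \<Rightarrow> real) \<Rightarrow> real"
  assumes "continuous_on {z :: real ^ 'a. \<forall>i. z $ i \<ge> 0} (\<lambda>z. F (\<lambda>i. z $ i))"
  shows "\<exists>p. \<forall>p'. F (pmf p') \<le> F (pmf p)"
proof -
  let ?S = "{z :: real ^ 'a. (\<forall>i. z $ i \<ge> 0) \<and> (\<Sum>i\<in>UNIV. z $ i) = 1}"
  have pmf_in: "(\<chi> i. pmf p i) \<in> ?S" for p
    by (simp add: sum_pmf_eq_1)
  have "closed ?S"
    by (intro closed_Collect_conj closed_Collect_all closed_Collect_le closed_Collect_eq continuous_intros)
  moreover have "?S \<subseteq> cbox 0 1"
  proof
    fix z assume "z \<in> ?S"
    then have "z $ i \<le> 1" for i using member_le_sum[of i UNIV "\<lambda>i. z $ i"] by simp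
    with \<open>z \<in> ?S\<close> show "z \<in> cbox 0 1" by (simp add: mem_box_cart)
  qed
  ultimately have "compact ?S"
    by (metis (no_types, lifting) bounded_cbox bounded_subset compact_eq_bounded_closed)
  moreover have "?S \<noteq> {}" using pmf_in by blast
  moreover have "continuous_on ?S (\<lambda>z. F (\<lambda>i. z $ i))"
    by (rule continuous_on_subset[OF assms]) auto
  ultimately obtain z where z: "z \<in> ?S" "\<And>z'. z' \<in> ?S \<Longrightarrow> F (\<lambda>i. z' $ i) \<le> F (\<lambda>i. z $ i)"
    using continuous_attains_sup[of ?S "\<lambda>z. F (\<lambda>i. z $ i)"] by auto
  obtain p where "\<And>i. pmf p i = z $ i"
    using ex_pmf_eq[of "\<lambda>i. z $ i"] z(1) by auto
  then have "pmf p = (\<lambda>i. z $ i)" by auto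
  then have "F (pmf p') \<le> F (pmf p)" for p'
    using z(2)[OF pmf_in[of p']] by simp
  then show ?thesis by blast
qed

lemma ex_optimal_input:
  fixes V :: "'u::finite \<Rightarrow> 'v::finite pmf"
  assumes "\<alpha> > 0"
  shows "\<exists>p. \<forall>p'. (\<alpha> - 1) * gallager_sum \<alpha> p' V \<le> (\<alpha> - 1) * gallager_sum \<alpha> p V"
  unfolding gallager_sum_def
proof (rule ex_maximizing_pmf)
  show "continuous_on {z :: real ^ 'u. \<forall>i. z $ i \<ge> 0}
      (\<lambda>z. (\<alpha> - 1) * (\<Sum>y\<in>UNIV. (\<Sum>x\<in>UNIV. z $ x * pmf (V x) y powr \<alpha>) powr (1 / \<alpha>)))"
    using assms by (intro continuous_intros continuous_on_powr') (auto intro!: sum_nonneg)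
qed

text \<open>A one-sided derivative that includes the boundary point \<open>h = 0\<close>. There the
  quotient is \<open>w powr \<beta> * t powr (\<beta> - 1)\<close>: it tends to zero for \<beta> >
  1, and its blow-up for \<beta> < 1 is excluded by the assumption \<open>0\<close>.\<close>

lemma tendsto_powr_quotient:
  fixes h w \<beta> :: real
  assumes "h \<ge> 0" "w \<ge> 0" "\<beta> > 0" and 0: "\<beta> < 1 \<Longrightarrow> h = 0 \<Longrightarrow> w = 0" and "\<beta> \<noteq> 1"
  shows "((\<lambda>t. ((h + t * (w - h)) powr \<beta> - h powr \<beta>) / t) \<longlongrightarrow> \<beta> * (h powr (\<beta> - 1) * (w - h))) (at_right 0)"
proof (cases "h = 0")
  case False
  then have "((\<lambda>t. (h + t * (w - h)) powr \<beta>) has_real_derivative \<beta> * (h powr (\<beta> - 1) * (w - h))) (at 0 within {0<..})"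
    using assms(1) by (auto intro!: derivative_eq_intros simp: powr_diff)
  then show ?thesis by (simp add: has_field_derivative_iff)
next
  case h: True
  show ?thesis
  proof (cases "w = 0")
    case False
    then have "\<beta> > 1" using 0 h \<open>\<beta> \<noteq> 1\<close> by force
    then have "((\<lambda>t. w powr \<beta> * t powr (\<beta> - 1)) \<longlongrightarrow> w powr \<beta> * 0 powr (\<beta> - 1)) (at_right 0)"
      by (intro tendsto_intros) (auto simp: eventually_at_filter)
    then have "((\<lambda>t. w powr \<beta> * t powr (\<beta> - 1)) \<longlongrightarrow> 0) (at_right 0)" by simp
    moreover have "eventually (\<lambda>t. w powr \<beta> * t powr (\<beta> - 1) = ((h + t * (w - h)) powr \<beta> - h powr \<beta>) / t) (at_right 0)"
      using \<open>w \<ge> 0\<close> by (auto simp: eventually_at_filter h powr_mult powr_diff)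
    ultimately show ?thesis
      by (auto simp: h intro: Lim_transform_eventually)
  qed (simp add: h)
qed

text \<open>
  These are the Karush-Kuhn-Tucker conditions at an optimal input distribution \<open>p\<close>: the output
  distribution proportional to \<open>g y = (\<Sum>x. p x * V(y|x)\<^sup>\<alpha>) powr (1/\<alpha>)\<close> has the optimal
  worst-case divergence.
\<close>

lemma ex_dual_optimal_output:
  fixes V :: "'u::finite \<Rightarrow> 'v::finite pmf"
  assumes \<alpha>: "\<alpha> > 0" "\<alpha> \<noteq> 1"
  shows "\<exists>p q. (\<forall>u. (\<alpha> - 1) * (\<Sum>v\<in>UNIV. renyi_term \<alpha> (pmf (V u) v) (pmf q v))
             \<le> (\<alpha> - 1) * gallager_sum \<alpha> p V powr \<alpha>) \<and>
           (\<alpha> > 1 \<longrightarrow> (\<forall>u. set_pmf (V u) \<subseteq> set_pmf q))"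
proof -
  obtain p where p: "\<And>p'. (\<alpha> - 1) * gallager_sum \<alpha> p' V \<le> (\<alpha> - 1) * gallager_sum \<alpha> p V"
    using ex_optimal_input[OF \<alpha>(1)] by blast
  define G where "G = gallager_sum \<alpha> p V"
  define h where "h y = (\<Sum>x\<in>UNIV. pmf p x * pmf (V x) y powr \<alpha>)" for y
  have G: "G = (\<Sum>y\<in>UNIV. h y powr (1 / \<alpha>))" "G > 0"
    unfolding G_def by (simp add: gallager_sum_def h_def, rule gallager_sum_pos)
  have h: "h y \<ge> 0" for y by (simp add: h_def sum_nonneg)
  \<comment> \<open>The optimum is tested by shifting mass \<open>t\<close> from \<open>p\<close> to
    the point mass at \<open>u\<close>; \<open>h\<close> is affine along this segment.\<close>
  have opt: "(\<alpha> - 1) * (\<Sum>y\<in>UNIV. (h y + t * (pmf (V u) y powr \<alpha> - h y)) powr (1 / \<alpha>)) \<le> (\<alpha> - 1) * G"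
    if t: "0 < t" "t < 1" for t u
  proof -
    obtain p' where p': "pmf p' x = (1 - t) * pmf p x + t * (if x = u then 1 else 0)" for x
    proof (rule ex_pmf_eq)
      show "(\<Sum>x\<in>UNIV. (1 - t) * pmf p x + t * (if x = u then 1 else 0)) = 1"
        unfolding sum.distrib sum_distrib_left[symmetric] by (simp add: sum_pmf_eq_1)
    qed (use t in auto)
    have "(\<Sum>x\<in>UNIV. pmf p' x * pmf (V x) y powr \<alpha>) = h y + t * (pmf (V u) y powr \<alpha> - h y)" for y
    proof -
      have "(\<Sum>x\<in>UNIV. pmf p' x * pmf (V x) y powr \<alpha>) =
          (\<Sum>x\<in>UNIV. (1 - t) * (pmf p x * pmf (V x) y powr \<alpha>) + t * (if x = u then pmf (V u) y powr \<alpha> else 0))"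
        by (intro sum.cong refl) (simp add: p' algebra_simps)
      also have "\<dots> = (1 - t) * h y + t * pmf (V u) y powr \<alpha>"
        by (simp add: sum.distrib h_def flip: sum_distrib_left)
      finally show ?thesis by (simp add: algebra_simps)
    qed
    then show ?thesis using p[of p'] by (simp add: gallager_sum_def[of \<alpha> p'] G_def)
  qed
  \<comment> \<open>If an output reachable from \<open>u\<close> had \<open>h y = 0\<close>, the
    shift would gain order t^(1/\<alpha>) at \<open>y\<close> and lose at most \<open>t * G\<close>
    elsewhere. For \<alpha> > 1 the gain dominates as t tends to zero, against optimality.\<close>
  have pos: "h y > 0" if "\<alpha> > 1" "pmf (V u) y \<noteq> 0" for u y
  proof (rule ccontr)
    assume "\<not> h y > 0"
    then have hy: "h y = 0" using h[of y] by simp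
    \<comment> \<open>\<open>w\<close> equals \<open>pmf (V u) y\<close>, written in the form that
      \<open>powr_powr\<close> produces.\<close>
    define w where "w = pmf (V u) y powr (\<alpha> * (1 / \<alpha>))"
    have "w \<le> t powr (1 - 1 / \<alpha>) * G" if t: "0 < t" "t < 1" for t
    proof -
      have "t powr (1 / \<alpha>) * w \<le> t * G"
      proof -
        have "(1 - t) * G + t powr (1 / \<alpha>) * w =
            (\<Sum>z\<in>UNIV. (1 - t) * h z powr (1 / \<alpha>) + (if z = y then t powr (1 / \<alpha>) * w else 0))"
          unfolding sum.distrib sum_distrib_left[symmetric] by (simp add: G(1))
        also have "\<dots> \<le> (\<Sum>z\<in>UNIV. (h z + t * (pmf (V u) z powr \<alpha> - h z)) powr (1 / \<alpha>))"
        proof (rule sum_mono)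
          fix z
          have "(1 - t) * h z powr (1 / \<alpha>) \<le> (1 - t) powr (1 / \<alpha>) * h z powr (1 / \<alpha>)"
            using t \<open>\<alpha> > 1\<close> powr_mono'[of "1 / \<alpha>" 1 "1 - t"] by (intro mult_right_mono) auto
          also have "\<dots> = ((1 - t) * h z) powr (1 / \<alpha>)"
            using t h by (simp add: powr_mult)
          also have "\<dots> \<le> (h z + t * (pmf (V u) z powr \<alpha> - h z)) powr (1 / \<alpha>)"
            using t h \<alpha> by (intro powr_mono2) (auto simp: algebra_simps mult_left_le_one_le)
          finally show "(1 - t) * h z powr (1 / \<alpha>) + (if z = y then t powr (1 / \<alpha>) * w else 0)
              \<le> (h z + t * (pmf (V u) z powr \<alpha> - h z)) powr (1 / \<alpha>)"
            using t by (auto simp: hy w_def powr_mult powr_powr)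
        qed
        also have "\<dots> \<le> G"
          using opt[OF t] \<open>\<alpha> > 1\<close> by simp
        finally show ?thesis by (simp add: algebra_simps)
      qed
      then show ?thesis
        using t by (simp add: powr_diff pos_le_divide_eq mult.commute)
    qed
    then have "eventually (\<lambda>t. w \<le> t powr (1 - 1 / \<alpha>) * G) (at_right 0)"
      by (intro eventually_mono[OF eventually_at_right_real[of 0 1]]) auto
    moreover have "((\<lambda>t. t powr (1 - 1 / \<alpha>) * G) \<longlongrightarrow> 0 powr (1 - 1 / \<alpha>) * G) (at_right 0)"
      using \<open>\<alpha> > 1\<close> by (intro tendsto_intros) (auto simp: eventually_at_filter)
    ultimately have "w \<le> 0 powr (1 - 1 / \<alpha>) * G"
      by (intro tendsto_lowerbound) auto
    moreover have "w > 0" using that by (simp add: w_def)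
    ultimately show False by simp
  qed
  \<comment> \<open>The right derivative of the objective at the optimum, in the direction of
    \<open>u\<close>, is nonpositive. Its constant part is again \<open>G\<close>, since
    h^(1/\<alpha> - 1) times h is h^(1/\<alpha>).\<close>
  have kkt: "(\<alpha> - 1) * (\<Sum>y\<in>UNIV. h y powr (1 / \<alpha> - 1) * pmf (V u) y powr \<alpha>) \<le> (\<alpha> - 1) * G" for u
  proof -
    let ?w = "\<lambda>y. pmf (V u) y powr \<alpha>"
    have "((\<lambda>t. (\<alpha> - 1) * (\<Sum>y\<in>UNIV. ((h y + t * (?w y - h y)) powr (1 / \<alpha>) - h y powr (1 / \<alpha>)) / t))
        \<longlongrightarrow> (\<alpha> - 1) * (\<Sum>y\<in>UNIV. 1 / \<alpha> * (h y powr (1 / \<alpha> - 1) * (?w y - h y)))) (at_right 0)"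
    proof (intro tendsto_mult tendsto_const tendsto_sum tendsto_powr_quotient)
      \<comment> \<open>The fact \<open>pos\<close> rules out an infinite slope when 1/\<alpha> <
        1.\<close>
      show "?w y = 0" if "1 / \<alpha> < 1" "h y = 0" for y
        using pos[of u y] that \<alpha> by auto
    qed (use \<alpha> h in auto)
    moreover have "eventually (\<lambda>t. (\<alpha> - 1) *
        (\<Sum>y\<in>UNIV. ((h y + t * (?w y - h y)) powr (1 / \<alpha>) - h y powr (1 / \<alpha>)) / t) \<le> 0) (at_right 0)"
    proof -
      have "(\<alpha> - 1) * (\<Sum>y\<in>UNIV. ((h y + t * (?w y - h y)) powr (1 / \<alpha>) - h y powr (1 / \<alpha>)) / t) \<le> 0"
        if t: "0 < t" "t < 1" for t
      proof -
        have "(\<alpha> - 1) * (\<Sum>y\<in>UNIV. ((h y + t * (?w y - h y)) powr (1 / \<alpha>) - h y powr (1 / \<alpha>)) / t) =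
          ((\<alpha> - 1) * (\<Sum>y\<in>UNIV. (h y + t * (?w y - h y)) powr (1 / \<alpha>)) - (\<alpha> - 1) * G) / t"
          by (simp add: G sum_subtractf right_diff_distrib flip: sum_divide_distrib)
        also have "\<dots> \<le> 0" using opt[OF t, of u] t by (simp add: divide_nonpos_pos)
        finally show ?thesis .
      qed
      then show ?thesis by (intro eventually_mono[OF eventually_at_right_real[of 0 1]]) auto
    qed
    ultimately have "(\<alpha> - 1) * (\<Sum>y\<in>UNIV. 1 / \<alpha> * (h y powr (1 / \<alpha> - 1) * (?w y - h y))) \<le> 0"
      by (intro tendsto_upperbound) auto
    also have "(\<Sum>y\<in>UNIV. 1 / \<alpha> * (h y powr (1 / \<alpha> - 1) * (?w y - h y))) =
        1 / \<alpha> * ((\<Sum>y\<in>UNIV. h y powr (1 / \<alpha> - 1) * ?w y) - (\<Sum>y\<in>UNIV. h y powr (1 / \<alpha> - 1) * h y))"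
      by (simp only: sum_distrib_left right_diff_distrib sum_subtractf)
    also have "(\<Sum>y\<in>UNIV. h y powr (1 / \<alpha> - 1) * h y) = G"
      unfolding G(1) using h by (intro sum.cong refl) (auto simp: powr_diff)
    also have "(\<alpha> - 1) * (b * (S - G)) = b * ((\<alpha> - 1) * S - (\<alpha> - 1) * G)" for b S
      by (simp add: algebra_simps)
    finally have "1 / \<alpha> * ((\<alpha> - 1) * (\<Sum>y\<in>UNIV. h y powr (1 / \<alpha> - 1) * ?w y) - (\<alpha> - 1) * G) \<le> 0" .
    then show ?thesis using \<alpha> by (simp add: divide_le_0_iff)
  qed
  obtain q where q: "pmf q y = h y powr (1 / \<alpha>) / G" for y
    using ex_pmf_eq[of "\<lambda>y. h y powr (1 / \<alpha>) / G"] G by (auto simp flip: sum_divide_distrib)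
  have "(\<alpha> - 1) * (\<Sum>v\<in>UNIV. renyi_term \<alpha> (pmf (V u) v) (pmf q v)) \<le> (\<alpha> - 1) * G powr \<alpha>" for u
  proof -
    have "renyi_term \<alpha> (pmf (V u) y) (pmf q y) = G powr (\<alpha> - 1) * (h y powr (1 / \<alpha> - 1) * pmf (V u) y powr \<alpha>)" for y
    proof -
      have "1 / \<alpha> * (1 - \<alpha>) = 1 / \<alpha> - 1" using \<alpha> by (simp add: field_simps)
      moreover have "inverse (G powr (1 - \<alpha>)) = G powr (\<alpha> - 1)"
        by (simp flip: powr_minus)
      moreover have "(h y powr (1 / \<alpha>) / G) powr (1 - \<alpha>) = h y powr (1 / \<alpha> * (1 - \<alpha>)) * inverse (G powr (1 - \<alpha>))"
        using G(2) by (subst powr_divide) (auto simp: powr_powr divide_inverse)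
      ultimately have "(h y powr (1 / \<alpha>) / G) powr (1 - \<alpha>) = h y powr (1 / \<alpha> - 1) * G powr (\<alpha> - 1)"
        by simp
      then show ?thesis by (simp add: renyi_term_def q)
    qed
    then have "(\<alpha> - 1) * (\<Sum>v\<in>UNIV. renyi_term \<alpha> (pmf (V u) v) (pmf q v)) =
        G powr (\<alpha> - 1) * ((\<alpha> - 1) * (\<Sum>y\<in>UNIV. h y powr (1 / \<alpha> - 1) * pmf (V u) y powr \<alpha>))"
      by (simp add: mult.left_commute flip: sum_distrib_left)
    also have "\<dots> \<le> G powr (\<alpha> - 1) * ((\<alpha> - 1) * G)"
      by (intro mult_left_mono kkt) simp
    also have "\<dots> = (\<alpha> - 1) * G powr \<alpha>"
      using G(2) by (simp add: powr_diff)
    finally show ?thesis .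
  qed
  moreover have "set_pmf (V u) \<subseteq> set_pmf q" if "\<alpha> > 1" for u
    using pos[OF that, of u] G(2) by (fastforce simp: set_pmf_iff q)
  ultimately show ?thesis unfolding G_def by blast
qed

section \<open>Monotonicity of the capacity at orders other than one\<close>

lemma alpha_capacity_eq:
  "\<alpha> \<noteq> 1 \<Longrightarrow> alpha_capacity \<alpha> W = (SUP p. ereal (\<alpha> / (\<alpha> - 1) * log 2 (gallager_sum \<alpha> p W)))"
  by (simp add: alpha_capacity_def gallager_sum_def)

text \<open>The dual output \<open>q\<close> of \<open>V\<close> has worst-case Renyi sum bounded
  through the value at the optimal input \<open>p\<close>. This bound transfers to each input of
  \<open>W\<close>; after roots and logarithms, the sign of \<alpha> / (\<alpha> - 1) restores one
  direction for both cases.\<close>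

lemma alpha_capacity_mono:
  fixes W :: "'x::finite \<Rightarrow> 'y::finite pmf" and V :: "'u::finite \<Rightarrow> 'v::finite pmf"
  assumes sim: "exactly_simulable W V" and \<alpha>: "\<alpha> > 0" "\<alpha> \<noteq> 1"
  shows "alpha_capacity \<alpha> W \<le> alpha_capacity \<alpha> V"
proof -
  obtain p q where dual: "\<And>u. (\<alpha> - 1) * (\<Sum>v\<in>UNIV. renyi_term \<alpha> (pmf (V u) v) (pmf q v))
             \<le> (\<alpha> - 1) * gallager_sum \<alpha> p V powr \<alpha>"
      "\<And>u. \<alpha> > 1 \<Longrightarrow> set_pmf (V u) \<subseteq> set_pmf q"
    using ex_dual_optimal_output[OF \<alpha>, of V] by blast
  have "\<alpha> / (\<alpha> - 1) * log 2 (gallager_sum \<alpha> p' W) \<le> \<alpha> / (\<alpha> - 1) * log 2 (gallager_sum \<alpha> p V)" for p'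
  proof -
    have "(\<alpha> - 1) * gallager_sum \<alpha> p' W powr \<alpha> \<le> (\<alpha> - 1) * gallager_sum \<alpha> p V powr \<alpha>"
      by (rule simulable_gallager_sum_le[where q = q]) (fact sim \<alpha>(1) dual powr_ge_zero)+
    moreover have le_iff: "x powr \<alpha> \<le> y powr \<alpha> \<longleftrightarrow> x \<le> y" if "x > 0" "y > 0" for x y :: real
      using that \<alpha>(1) powr_less_mono2[of \<alpha> y x] powr_mono2[of \<alpha> x y] by linarith
    ultimately have "if \<alpha> > 1 then gallager_sum \<alpha> p' W \<le> gallager_sum \<alpha> p V
        else gallager_sum \<alpha> p V \<le> gallager_sum \<alpha> p' W"
      using \<alpha>(2) by (auto simp: mult_diff_1_le_cancel le_iff[OF gallager_sum_pos gallager_sum_pos] split: if_splits)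
    then have log: "if \<alpha> > 1 then log 2 (gallager_sum \<alpha> p' W) \<le> log 2 (gallager_sum \<alpha> p V)
        else log 2 (gallager_sum \<alpha> p V) \<le> log 2 (gallager_sum \<alpha> p' W)"
      by (simp add: gallager_sum_pos split: if_splits)
    then show ?thesis
    proof (cases "\<alpha> > 1")
      case True
      with log show ?thesis by (intro mult_left_mono) auto
    next
      case False
      then have "\<alpha> / (\<alpha> - 1) \<le> 0" using \<alpha> by (intro divide_nonneg_neg) auto
      with False log show ?thesis by (intro mult_left_mono_neg) auto
    qed
  qed
  then show ?thesis
    unfolding alpha_capacity_eq[OF \<alpha>(2)] by (intro SUP_least SUP_upper2[of p]) auto
qed

section \<open>The limit from below at order one\<close>

lemma sum_renyi_term_pos:
  assumes "finite I" and a: "\<And>i. i \<in> I \<Longrightarrow> a i \<ge> 0" "sum a I = 1" and b: "\<And>i. i \<in> I \<Longrightarrow> b i \<ge> 0"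
    and ac: "\<And>i. i \<in> I \<Longrightarrow> b i = 0 \<Longrightarrow> a i = 0"
  shows "(\<Sum>i\<in>I. renyi_term \<alpha> (a i) (b i)) > 0"
proof -
  have "\<exists>i\<in>I. a i \<noteq> 0" using a(2) sum.neutral[of I a] by (metis zero_neq_one)
  then obtain i where i: "i \<in> I" "a i \<noteq> 0" by blast
  moreover have "b i \<noteq> 0" using ac i by blast
  ultimately show ?thesis
    using \<open>finite I\<close> by (intro sum_pos2[of I i]) (auto simp: renyi_term_def)
qed

text \<open>Jensen's inequality for the logarithm: \<open>S\<close> is the mean under
  \<open>a\<close> of (b/a)^(1 - \<alpha>). It is proved termwise from
  \<open>ln_le_minus_one\<close> at the ratio of each value to this mean.\<close>

lemma log_renyi_sum_le_relative_entropy: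
  assumes "\<alpha> < 1" "finite I" and a: "\<And>i. i \<in> I \<Longrightarrow> a i \<ge> 0" "sum a I = 1" and b: "\<And>i. i \<in> I \<Longrightarrow> b i \<ge> 0"
    and ac: "\<And>i. i \<in> I \<Longrightarrow> b i = 0 \<Longrightarrow> a i = 0"
  shows "1 / (\<alpha> - 1) * log 2 (\<Sum>i\<in>I. renyi_term \<alpha> (a i) (b i)) \<le> (\<Sum>i\<in>I. a i * log 2 (a i / b i))"
proof -
  define S where "S = (\<Sum>i\<in>I. renyi_term \<alpha> (a i) (b i))"
  define K where "K = (\<Sum>i\<in>I. a i * ln (a i / b i))"
  have S: "S > 0" unfolding S_def by (rule sum_renyi_term_pos) (use assms in auto)
  have "(\<alpha> - 1) * (a i * ln (a i / b i)) - a i * ln S \<le> renyi_term \<alpha> (a i) (b i) / S - a i" if i: "i \<in> I" for i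
  proof (cases "a i = 0")
    case False
    then have pos: "a i > 0" "b i > 0" using a(1)[OF i] b[OF i] ac[OF i] by force+
    define t where "t = (b i / a i) powr (1 - \<alpha>)"
    have t: "t > 0" "renyi_term \<alpha> (a i) (b i) = a i * t"
      using pos by (simp_all add: t_def renyi_term_def powr_divide powr_diff)
    have "ln (t / S) \<le> t / S - 1" using S t by (intro ln_le_minus_one) simp
    moreover have "ln (t / S) = (\<alpha> - 1) * ln (a i / b i) - ln S"
      using pos S t by (simp add: ln_div t_def ln_powr algebra_simps)
    ultimately have "a i * ((\<alpha> - 1) * ln (a i / b i) - ln S) \<le> a i * (t / S - 1)"
      using pos by (intro mult_left_mono) auto
    then show ?thesis by (simp add: t(2) algebra_simps)
  qed simp
  then have "(\<Sum>i\<in>I. (\<alpha> - 1) * (a i * ln (a i / b i)) - a i * ln S)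
      \<le> (\<Sum>i\<in>I. renyi_term \<alpha> (a i) (b i) / S - a i)"
    by (rule sum_mono)
  then have "(\<alpha> - 1) * K \<le> ln S"
    using S a(2) by (simp add: sum_subtractf K_def S_def flip: sum_distrib_left sum_distrib_right sum_divide_distrib)
  then have "ln S / (\<alpha> - 1) \<le> K" using \<open>\<alpha> < 1\<close> by (simp add: neg_divide_le_eq mult.commute)
  then have "ln S / (\<alpha> - 1) / ln 2 \<le> K / ln 2" by (intro divide_right_mono) auto
  then show ?thesis
    by (simp add: log_def S_def K_def sum_divide_distrib mult.commute)
qed

lemma has_real_derivative_sum_renyi_term:
  assumes "finite I" and a: "\<And>i. i \<in> I \<Longrightarrow> a i \<ge> 0" and b: "\<And>i. i \<in> I \<Longrightarrow> b i \<ge> 0"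
    and ac: "\<And>i. i \<in> I \<Longrightarrow> b i = 0 \<Longrightarrow> a i = 0"
  shows "((\<lambda>\<alpha>. \<Sum>i\<in>I. renyi_term \<alpha> (a i) (b i)) has_real_derivative (\<Sum>i\<in>I. a i * ln (a i / b i))) (at 1)"
proof (rule DERIV_sum)
  fix i assume i: "i \<in> I"
  show "((\<lambda>\<alpha>. renyi_term \<alpha> (a i) (b i)) has_real_derivative a i * ln (a i / b i)) (at 1)"
  proof (cases "a i = 0")
    case False
    then have pos: "a i > 0" "b i > 0" using a[OF i] b[OF i] ac[OF i] by force+
    have "renyi_term \<alpha> (a i) (b i) = exp (\<alpha> * ln (a i) + (1 - \<alpha>) * ln (b i))" for \<alpha>
      using pos by (simp add: renyi_term_def powr_def exp_add)
    moreover have "((\<lambda>\<alpha>. exp (\<alpha> * ln (a i) + (1 - \<alpha>) * ln (b i))) has_real_derivative a i * ln (a i / b i)) (at 1)"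
      using pos by (auto intro!: derivative_eq_intros simp: ln_div)
    ultimately show ?thesis by simp
  qed simp
qed

lemma tendsto_divide_at_left_1:
  fixes f :: "real \<Rightarrow> real"
  assumes "(f has_real_derivative D) (at 1)" "f 1 = 0"
  shows "((\<lambda>\<alpha>. f \<alpha> / (\<alpha> - 1)) \<longlongrightarrow> D) (at_left 1)"
proof -
  have "(f has_real_derivative D) (at_left 1)"
    using assms(1) by (rule has_field_derivative_at_within)
  then show ?thesis using assms(2) by (simp add: has_field_derivative_iff)
qed

lemma has_real_derivative_log:
  fixes f :: "real \<Rightarrow> real"
  assumes "(f has_real_derivative D) (at x)" "f x = 1"
  shows "((\<lambda>z. log b (f z)) has_real_derivative D / ln b) (at x)"
  unfolding log_def using assms by (auto intro!: derivative_eq_intros simp: divide_inverse)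

lemma renyi_divergence_eq:
  assumes "0 < \<alpha>" "\<alpha> < 1" "set_pmf p \<subseteq> set_pmf q"
  shows "renyi_divergence \<alpha> p q =
    ereal (1 / (\<alpha> - 1) * log 2 (\<Sum>x\<in>UNIV. renyi_term \<alpha> (pmf p x) (pmf q x)))"
  using assms set_pmf_not_empty[of p] by (auto simp: renyi_divergence_def renyi_term_def)

lemma renyi_divergence_1_eq:
  assumes "set_pmf p \<subseteq> set_pmf q"
  shows "renyi_divergence 1 p q = ereal (\<Sum>x\<in>UNIV. pmf p x * log 2 (pmf p x / pmf q x))"
  using assms by (simp add: renyi_divergence_def KL_divergence_pmf)

lemma renyi_divergence_le_1:
  assumes "0 < \<alpha>" "\<alpha> < 1"
  shows "renyi_divergence \<alpha> p q \<le> renyi_divergence 1 p q"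
proof (cases "set_pmf p \<subseteq> set_pmf q")
  case True
  then show ?thesis
    unfolding renyi_divergence_eq[OF assms True] renyi_divergence_1_eq[OF True] ereal_less_eq
    using assms by (intro log_renyi_sum_le_relative_entropy) (auto simp: sum_pmf_eq_1 set_pmf_iff)
qed (simp add: renyi_divergence_def)

lemma eventually_at_left_1: "eventually (\<lambda>\<alpha>. 0 < \<alpha> \<and> \<alpha> < (1 :: real)) (at_left 1)"
  using eventually_at_left_real[of 0 1] by simp

lemma tendsto_renyi_divergence_1:
  assumes "set_pmf p \<subseteq> set_pmf q"
  shows "((\<lambda>\<alpha>. renyi_divergence \<alpha> p q) \<longlongrightarrow> renyi_divergence 1 p q) (at_left 1)"
proof -
  let ?S = "\<lambda>\<alpha>. \<Sum>x\<in>UNIV. renyi_term \<alpha> (pmf p x) (pmf q x)"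
  let ?D = "\<Sum>x\<in>UNIV. pmf p x * ln (pmf p x / pmf q x)"
  have ac: "pmf q x = 0 \<Longrightarrow> pmf p x = 0" for x
    using assms by (auto simp: set_pmf_iff)
  \<comment> \<open>As \<open>0 powr 0\<close> is zero, points outside the support of
    \<open>q\<close> contribute nothing; absolute continuity ensures that \<open>p\<close> loses no
    mass there.\<close>
  have S1: "?S 1 = 1"
  proof -
    have "?S 1 = (\<Sum>x\<in>UNIV. pmf p x)"
      using ac by (intro sum.cong refl) (auto simp: renyi_term_def)
    then show ?thesis by (simp add: sum_pmf_eq_1)
  qed
  have "(?S has_real_derivative ?D) (at 1)"
    using ac by (intro has_real_derivative_sum_renyi_term) auto
  then have "((\<lambda>\<alpha>. log 2 (?S \<alpha>)) has_real_derivative ?D / ln 2) (at 1)"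
    by (rule has_real_derivative_log) (rule S1)
  then have "((\<lambda>\<alpha>. log 2 (?S \<alpha>) / (\<alpha> - 1)) \<longlongrightarrow> ?D / ln 2) (at_left 1)"
    by (rule tendsto_divide_at_left_1) (simp add: S1)
  then have "((\<lambda>\<alpha>. ereal (log 2 (?S \<alpha>) / (\<alpha> - 1))) \<longlongrightarrow> renyi_divergence 1 p q) (at_left 1)"
    unfolding renyi_divergence_1_eq[OF assms] by (simp add: log_def sum_divide_distrib)
  moreover have "eventually (\<lambda>\<alpha>. ereal (log 2 (?S \<alpha>) / (\<alpha> - 1)) = renyi_divergence \<alpha> p q) (at_left 1)"
    by (rule eventually_mono[OF eventually_at_left_1]) (simp add: renyi_divergence_eq assms)
  ultimately show ?thesis by (rule Lim_transform_eventually)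
qed

section \<open>Mutual information as a limit of the Gallager functional\<close>

lemma joint_output_eq_0:
  "pmf p x * pmf (output_pmf p W) y = 0 \<Longrightarrow> pmf p x * pmf (W x) y = 0"
  for p :: "'x::finite pmf"
  by (auto simp: pmf_output_pmf sum_nonneg_eq_0_iff)

text \<open>The factor \<open>pmf p x\<close> is reinserted in numerator and denominator so that the
  relative entropy inequality applies to the joint law and the product of its marginals.\<close>

lemma channel_mutual_information_eq_relative_entropy:
  fixes p :: "'x::finite pmf" and W :: "'x \<Rightarrow> 'y::finite pmf"
  shows "channel_mutual_information p W = (\<Sum>(x, y)\<in>UNIV \<times> UNIV. pmf p x * pmf (W x) y *
      log 2 (pmf p x * pmf (W x) y / (pmf p x * pmf (output_pmf p W) y)))"
  unfolding channel_mutual_information_eq sum.cartesian_product by (intro sum.cong refl) auto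

text \<open>Two bounds are chained: Sibson's inequality with the true output law as reference, then
  the comparison of order \<alpha> with relative entropy.\<close>

lemma gallager_le_mutual_information:
  fixes p :: "'x::finite pmf" and W :: "'x \<Rightarrow> 'y::finite pmf"
  assumes \<alpha>: "0 < \<alpha>" "\<alpha> < 1"
  shows "\<alpha> / (\<alpha> - 1) * log 2 (gallager_sum \<alpha> p W) \<le> channel_mutual_information p W"
proof -
  let ?r = "pmf (output_pmf p W)"
  let ?a = "\<lambda>(x, y). pmf p x * pmf (W x) y" and ?b = "\<lambda>(x, y). pmf p x * ?r y"
  define T where "T = (\<Sum>z\<in>UNIV \<times> UNIV. renyi_term \<alpha> (?a z) (?b z))"
  have T: "T = (\<Sum>x\<in>UNIV. pmf p x * (\<Sum>y\<in>UNIV. renyi_term \<alpha> (pmf (W x) y) (?r y)))"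
    unfolding T_def sum.cartesian_product[symmetric] sum_distrib_left
    by (simp add: split_def renyi_term_scale sum.cartesian_product sum_distrib_left)
  have a1: "sum ?a (UNIV \<times> UNIV) = 1"
    unfolding sum.cartesian_product[symmetric] by (simp add: sum_pmf_eq_1 flip: sum_distrib_left)
  have "T > 0" unfolding T_def
    using a1 by (intro sum_renyi_term_pos) (auto dest: joint_output_eq_0)
  have "(\<alpha> - 1) * gallager_sum \<alpha> p W powr \<alpha> \<le> (\<alpha> - 1) * T"
    unfolding gallager_sum_def T
    by (rule powr_sum_le_renyi_sum) (use \<alpha> in \<open>auto simp: sum_pmf_eq_1\<close>)
  then have "T \<le> gallager_sum \<alpha> p W powr \<alpha>"
    using \<alpha> by (simp add: mult_diff_1_le_cancel)
  then have "log 2 T \<le> log 2 (gallager_sum \<alpha> p W powr \<alpha>)"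
    using \<open>T > 0\<close> by (intro log_mono) auto
  then have "1 / (\<alpha> - 1) * log 2 (gallager_sum \<alpha> p W powr \<alpha>) \<le> 1 / (\<alpha> - 1) * log 2 T"
    using \<alpha> by (intro mult_left_mono_neg) auto
  also have "\<dots> \<le> (\<Sum>z\<in>UNIV \<times> UNIV. ?a z * log 2 (?a z / ?b z))"
    unfolding T_def using \<alpha> a1
    by (intro log_renyi_sum_le_relative_entropy) (auto dest: joint_output_eq_0)
  also have "\<dots> = channel_mutual_information p W"
    unfolding channel_mutual_information_eq_relative_entropy by (simp add: split_def)
  finally show ?thesis by (simp add: log_powr gallager_sum_pos)
qed

text \<open>The Gallager sum is one at \<alpha> = 1, so the expression is a difference quotient of
  \<open>\<alpha> * log 2 (gallager_sum \<alpha> p W)\<close>, whose derivative there is the mutual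
  information.\<close>

lemma tendsto_gallager_mutual_information:
  fixes p :: "'x::finite pmf" and W :: "'x \<Rightarrow> 'y::finite pmf"
  shows "((\<lambda>\<alpha>. \<alpha> / (\<alpha> - 1) * log 2 (gallager_sum \<alpha> p W)) \<longlongrightarrow> channel_mutual_information p W) (at_left 1)"
proof -
  let ?r = "pmf (output_pmf p W)"
  let ?h = "\<lambda>\<alpha> y. \<Sum>x\<in>UNIV. pmf p x * pmf (W x) y powr \<alpha>"
  let ?D = "\<lambda>y. \<Sum>x\<in>UNIV. pmf p x * pmf (W x) y * ln (pmf (W x) y / ?r y)"
  have h1: "?h 1 y = ?r y" for y by (simp add: pmf_output_pmf)
  have deriv: "((\<lambda>\<alpha>. ?h \<alpha> y powr (1 / \<alpha>)) has_real_derivative ?D y) (at 1)" for y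
  \<comment> \<open>\<open>DERIV_powr\<close> requires a positive base; an output of probability
    zero gives the zero function of \<alpha> instead.\<close>
  proof (cases "?r y = 0")
    case True
    then have 0: "pmf p x * pmf (W x) y = 0" for x
      using joint_output_eq_0[of p x W y] by simp
    have "?h \<alpha> y = 0" for \<alpha>
      using 0 by (intro sum.neutral) auto
    moreover have "?D y = 0" using 0 by (intro sum.neutral) auto
    ultimately show ?thesis by simp
  next
    case False
    then have r: "?r y > 0" by (simp add: pmf_positive set_pmf_iff)
    have "((\<lambda>\<alpha>. pmf (W x) y powr \<alpha>) has_real_derivative pmf (W x) y * ln (pmf (W x) y)) (at 1)" for x
    proof (cases "pmf (W x) y = 0")
      case False
      then have "((\<lambda>\<alpha>. exp (\<alpha> * ln (pmf (W x) y))) has_real_derivative pmf (W x) y * ln (pmf (W x) y)) (at 1)"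
        by (auto intro!: derivative_eq_intros simp: less_le)
      then show ?thesis using False by (simp add: powr_def)
    qed simp
    then have h': "((\<lambda>\<alpha>. ?h \<alpha> y) has_real_derivative
        (\<Sum>x\<in>UNIV. pmf p x * (pmf (W x) y * ln (pmf (W x) y)))) (at 1)"
      by (intro DERIV_sum DERIV_cmult)
    have inv: "((\<lambda>\<alpha> :: real. 1 / \<alpha>) has_real_derivative - 1) (at 1)"
      by (auto intro!: derivative_eq_intros)
    have "((\<lambda>\<alpha>. ?h \<alpha> y powr (1 / \<alpha>)) has_real_derivative
        ?h 1 y powr (1 / 1) * (- 1 * ln (?h 1 y) +
          (\<Sum>x\<in>UNIV. pmf p x * (pmf (W x) y * ln (pmf (W x) y))) * (1 / 1) / ?h 1 y)) (at 1)"
      by (rule DERIV_powr[OF h' _ inv]) (simp only: h1 r)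
    also have "?h 1 y powr (1 / 1) * (- 1 * ln (?h 1 y) +
          (\<Sum>x\<in>UNIV. pmf p x * (pmf (W x) y * ln (pmf (W x) y))) * (1 / 1) / ?h 1 y) =
        (\<Sum>x\<in>UNIV. pmf p x * (pmf (W x) y * ln (pmf (W x) y))) - ?r y * ln (?r y)"
      unfolding h1 using r by (simp add: field_simps)
    also have "\<dots> = (\<Sum>x\<in>UNIV. pmf p x * (pmf (W x) y * ln (pmf (W x) y)) - pmf p x * pmf (W x) y * ln (?r y))"
      by (simp add: sum_subtractf pmf_output_pmf sum_distrib_right)
    also have "\<dots> = ?D y"
    proof (intro sum.cong refl)
      fix x
      show "pmf p x * (pmf (W x) y * ln (pmf (W x) y)) - pmf p x * pmf (W x) y * ln (?r y) =
          pmf p x * pmf (W x) y * ln (pmf (W x) y / ?r y)"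
        using r by (cases "pmf (W x) y = 0") (simp_all add: ln_div less_le algebra_simps)
    qed
    finally show ?thesis .
  qed
  have G1: "gallager_sum 1 p W = 1"
    by (simp add: gallager_sum_def sum_pmf_eq_1 flip: pmf_output_pmf)
  have "((\<lambda>\<alpha>. gallager_sum \<alpha> p W) has_real_derivative (\<Sum>y\<in>UNIV. ?D y)) (at 1)"
    unfolding gallager_sum_def by (intro DERIV_sum deriv)
  then have "((\<lambda>\<alpha>. \<alpha> * log 2 (gallager_sum \<alpha> p W)) has_real_derivative (\<Sum>y\<in>UNIV. ?D y) / ln 2) (at 1)"
    by (auto intro!: derivative_eq_intros simp: G1 divide_inverse)
  then have "((\<lambda>\<alpha>. \<alpha> * log 2 (gallager_sum \<alpha> p W) / (\<alpha> - 1)) \<longlongrightarrow> (\<Sum>y\<in>UNIV. ?D y) / ln 2) (at_left 1)"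
    by (rule tendsto_divide_at_left_1) (simp add: G1)
  moreover have "(\<Sum>y\<in>UNIV. ?D y) / ln 2 = channel_mutual_information p W"
    unfolding channel_mutual_information_eq
    by (subst sum.swap) (simp add: log_def sum_divide_distrib)
  ultimately show ?thesis by simp
qed

section \<open>Monotonicity at order one\<close>

lemma SUP_le_if_tendsto_at_left_1:
  fixes F :: "real \<Rightarrow> 'i \<Rightarrow> ereal"
  assumes lim: "\<And>i. ((\<lambda>\<alpha>. F \<alpha> i) \<longlongrightarrow> f i) (at_left 1)"
    and le: "\<And>\<alpha> i. 0 < \<alpha> \<Longrightarrow> \<alpha> < 1 \<Longrightarrow> F \<alpha> i \<le> c"
  shows "(SUP i. f i) \<le> c"
proof (rule SUP_least)
  fix i
  \<comment> \<open>The bound passes to the limit for each \<open>i\<close> separately, so no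
    exchange of limit and supremum occurs.\<close>
  have "eventually (\<lambda>\<alpha>. F \<alpha> i \<le> c) (at_left 1)"
    by (rule eventually_mono[OF eventually_at_left_1]) (use le in auto)
  then show "f i \<le> c" by (intro tendsto_upperbound[OF lim]) auto
qed

text \<open>The limit is taken from below because there the divergence of order \<alpha> is at most
  that of order one, which bounds the \<alpha>-diameter of \<open>V\<close> by its diameter at order
  one.\<close>

lemma channel_diameter_1_mono:
  fixes W :: "'x::finite \<Rightarrow> 'y::finite pmf" and V :: "'u::finite \<Rightarrow> 'v::finite pmf"
  assumes sim: "exactly_simulable W V"
  shows "channel_diameter 1 W \<le> channel_diameter 1 V"
proof (cases "\<exists>u u'. \<not> set_pmf (V u) \<subseteq> set_pmf (V u')")
  case True
  then obtain u u' where "\<not> set_pmf (V u) \<subseteq> set_pmf (V u')" by blast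
  then show ?thesis using channel_diameter_infinite[of 1 V u u'] by simp
next
  case False
  then have acV: "set_pmf (V u) \<subseteq> set_pmf (V u')" for u u' by blast
  have acW: "set_pmf (W x) \<subseteq> set_pmf (W x')" for x x'
    by (rule simulable_set_pmf_subset[OF sim acV])
  show ?thesis unfolding channel_diameter_def[of 1 W]
  proof (rule SUP_le_if_tendsto_at_left_1)
    fix z :: "'x pmf \<times> 'x pmf"
    show "((\<lambda>\<alpha>. case z of (p, q) \<Rightarrow> renyi_divergence \<alpha> (output_pmf p W) (output_pmf q W))
        \<longlongrightarrow> (case z of (p, q) \<Rightarrow> renyi_divergence 1 (output_pmf p W) (output_pmf q W))) (at_left 1)"
      unfolding split_def by (intro tendsto_renyi_divergence_1 set_pmf_output_subset acW)
  next
    fix \<alpha> :: real and z :: "'x pmf \<times> 'x pmf" assume \<alpha>: "0 < \<alpha>" "\<alpha> < 1"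
    have "(case z of (p, q) \<Rightarrow> renyi_divergence \<alpha> (output_pmf p W) (output_pmf q W)) \<le> channel_diameter \<alpha> W"
      unfolding channel_diameter_def by (rule SUP_upper) simp
    also have "\<dots> \<le> channel_diameter \<alpha> V"
      using sim \<alpha> by (intro channel_diameter_mono) auto
    also have "\<dots> \<le> channel_diameter 1 V"
      unfolding channel_diameter_def by (intro SUP_mono') (auto intro: renyi_divergence_le_1 \<alpha>)
    finally show "(case z of (p, q) \<Rightarrow> renyi_divergence \<alpha> (output_pmf p W) (output_pmf q W)) \<le> channel_diameter 1 V" .
  qed
qed

lemma alpha_capacity_1_mono:
  fixes W :: "'x::finite \<Rightarrow> 'y::finite pmf" and V :: "'u::finite \<Rightarrow> 'v::finite pmf"
  assumes sim: "exactly_simulable W V"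
  shows "alpha_capacity 1 W \<le> alpha_capacity 1 V"
proof -
  have "(SUP p. ereal (channel_mutual_information p W)) \<le> alpha_capacity 1 V"
  proof (rule SUP_le_if_tendsto_at_left_1)
    show "((\<lambda>\<alpha>. ereal (\<alpha> / (\<alpha> - 1) * log 2 (gallager_sum \<alpha> p W))) \<longlongrightarrow> ereal (channel_mutual_information p W)) (at_left 1)" for p
      by (intro tendsto_ereal tendsto_gallager_mutual_information)
  next
    fix \<alpha> :: real and p :: "'x pmf" assume \<alpha>: "0 < \<alpha>" "\<alpha> < 1"
    then have "\<alpha> \<noteq> 1" by simp
    have "ereal (\<alpha> / (\<alpha> - 1) * log 2 (gallager_sum \<alpha> p W)) \<le> alpha_capacity \<alpha> W"
      unfolding alpha_capacity_eq[OF \<open>\<alpha> \<noteq> 1\<close>] by (rule SUP_upper) simp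
    also have "\<dots> \<le> alpha_capacity \<alpha> V"
      using sim \<alpha> by (intro alpha_capacity_mono) auto
    also have "\<dots> \<le> alpha_capacity 1 V"
      unfolding alpha_capacity_eq[OF \<open>\<alpha> \<noteq> 1\<close>] unfolding alpha_capacity_def
      by (simp only: simp_thms if_True) (intro SUP_mono', simp only: ereal_less_eq gallager_le_mutual_information[OF \<alpha>])
    finally show "ereal (\<alpha> / (\<alpha> - 1) * log 2 (gallager_sum \<alpha> p W)) \<le> alpha_capacity 1 V" .
  qed
  then show ?thesis by (simp add: alpha_capacity_def[of 1 W])
qed

theorem theorem10:
  fixes W :: "'x::finite \<Rightarrow> 'y::finite pmf"
    and V :: "'u::finite \<Rightarrow> 'v::finite pmf"
    and \<alpha> :: real
  assumes "exactly_simulable W V"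
    and "\<alpha> > 0"
  shows "alpha_capacity \<alpha> W \<le> alpha_capacity \<alpha> V \<and>
         channel_diameter \<alpha> W \<le> channel_diameter \<alpha> V"
proof (cases "\<alpha> = 1")
  case True
  then show ?thesis
    using alpha_capacity_1_mono[OF assms(1)] channel_diameter_1_mono[OF assms(1)] by simp
next
  case False
  then show ?thesis
    using alpha_capacity_mono[OF assms False] channel_diameter_mono[OF assms False] by simp
qed

end
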